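(* Let $G$ be a series-parallel graph with terminals $u$ and $v$, and let $(X,Y)$ be a spin synchronization model on $G$ with arbitrary edge channels $Q=(Q_e)_{e\in E(G)}$. Then $$I_2(X_u; X_v \mid Y_{E(G)}) \leq \sum_{P \in \mathcal{P}_G(u,v)} I_2(X_u; X_v \mid Y_{E(P)}),$$ where $\mathcal{P}_G(u,v)$ is the set of paths (self-avoiding walks) from $u$ to $v$ in $G$.
   Context: Spin synchronization model: let $G$ be a finite graph with vertex set $V(G)$ and edge set $E(G)$. For each edge $e=(i,j)$ let $Q_e=Q_{ij}$ be a channel (Markov kernel) from $\{-1,+1\}$ to some output alphabet, i.e. a pair of probability distributions $Q_e(\cdot\mid +1)$, $Q_e(\cdot\mid -1)$. The pair $(X,Y)$ is a spin synchronization model on $G$ with edge channels $Q$ if $X=(X_w)_{w\in V(G)}$ are i.i.d. uniform on $\{-1,+1\}$ and, conditionally on $X$, the edge observations $Y=(Y_e)_{e\in E(G)}$ are independent with $Y_e\sim Q_e(\cdot\mid X_iX_j)$ for $e=(i,j)$. For $S\subseteq E(G)$, $Y_S=(Y_e)_{e\in S}$. No symmetry is assumed of the channels. Series-parallel graph with terminals $u\ne v$: (multi)graphs generated recursively as follows. A single edge joining $u$ and $v$ is series-parallel with terminals $u,v$. If $H_1$ is series-parallel with terminals $u,w$ and $H_2$ is series-parallel with terminals $w,v$, and they share only the vertex $w$, their union (series composition) is series-parallel with terminals $u,v$. If $H_1,H_2$ are both series-parallel with terminals $u,v$, share only the vertices $u,v$ and have disjoint edge sets, their union (parallel composition) is series-parallel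 with terminals $u,v$. Parallel edges are allowed; each edge has its own channel and observation, and paths using different edges are different paths. $E(P)$ denotes the set of edges of a path $P$. Chi-squared mutual information: for random variables $A,B$ with joint law $\nu_{A,B}$ and marginals $\nu_A,\nu_B$, with $\nu_{A,B}\ll\nu_A\times\nu_B$, $$I_2(A;B)=\int\left(\frac{d\nu_{A,B}}{d(\nu_A\times\nu_B)}-1\right)^2 d(\nu_A\times\nu_B).$$ The conditional version $I_2(A;B\mid C)$ is the expectation over $C$ of the chi-squared mutual information of $A$ and $B$ under their conditional joint law given $C$. *)

theory Defs
  imports "HOL-Probability.Probability"
begin

section \<open>Series-parallel multigraphs and their paths\<close>

text \<open>
  A multigraph consists of a vertex set, a set of edge names, and an incidence map sending an edge
  name to its two end vertices. Edges are undirected: the order of the two ends is irrelevant to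
  everything below.
\<close>

definition joins :: "('e \<Rightarrow> 'v \<times> 'v) \<Rightarrow> 'e \<Rightarrow> 'v \<Rightarrow> 'v \<Rightarrow> bool" where
  "joins ends e a b \<longleftrightarrow> ends e = (a, b) \<or> ends e = (b, a)"

definition finite_multigraph :: "('e \<Rightarrow> 'v \<times> 'v) \<Rightarrow> 'v set \<Rightarrow> 'e set \<Rightarrow> bool" where
  "finite_multigraph ends V E \<longleftrightarrow> finite V \<and> finite E \<and> (\<forall>e\<in>E. ends e \<in> V \<times> V)"

inductive series_parallel ::
    "('e \<Rightarrow> 'v \<times> 'v) \<Rightarrow> 'v set \<Rightarrow> 'e set \<Rightarrow> 'v \<Rightarrow> 'v \<Rightarrow> bool" for ends where
  single_edge: "joins ends e u v \<Longrightarrow> u \<noteq> v \<Longrightarrow> series_parallel ends {u, v} {e} u v"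
| series: "series_parallel ends V1 E1 u w \<Longrightarrow> series_parallel ends V2 E2 w v \<Longrightarrow>
    V1 \<inter> V2 = {w} \<Longrightarrow> series_parallel ends (V1 \<union> V2) (E1 \<union> E2) u v"
| parallel: "series_parallel ends V1 E1 u v \<Longrightarrow> series_parallel ends V2 E2 u v \<Longrightarrow>
    V1 \<inter> V2 = {u, v} \<Longrightarrow> E1 \<inter> E2 = {} \<Longrightarrow> series_parallel ends (V1 \<union> V2) (E1 \<union> E2) u v"

text \<open>
  A path is given by its vertices and its edges in order of traversal; with parallel edges the
  vertices alone would not determine it.
\<close>

definition paths ::
    "('e \<Rightarrow> 'v \<times> 'v) \<Rightarrow> 'v set \<Rightarrow> 'e set \<Rightarrow> 'v \<Rightarrow> 'v \<Rightarrow> ('v list \<times> 'e list) set" where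
  "paths ends V E u v = {(vs, es).
     length vs = Suc (length es) \<and> hd vs = u \<and> last vs = v \<and> distinct vs \<and>
     set vs \<subseteq> V \<and> set es \<subseteq> E \<and>
     (\<forall>i<length es. joins ends (es ! i) (vs ! i) (vs ! Suc i))}"

definition path_edges :: "'v list \<times> 'e list \<Rightarrow> 'e set" where
  "path_edges P = set (snd P)"


section \<open>Chi-squared mutual information\<close>

text \<open>
  \<open>chi2_info S T \<nu>\<close> is the chi-squared mutual information of the two coordinates under the joint
  law \<open>\<nu>\<close> on \<open>S \<Otimes>\<^sub>M T\<close>; it is infinite, by convention, if \<open>\<nu>\<close> is not absolutely continuous with
  respect to the product of its marginals.
\<close>

definition chi2_info :: "'b measure \<Rightarrow> 'c measure \<Rightarrow> ('b \<times> 'c) measure \<Rightarrow> ennreal" where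
  "chi2_info S T \<nu> =
    (let \<mu> = distr \<nu> S fst \<Otimes>\<^sub>M distr \<nu> T snd
     in if absolutely_continuous \<mu> \<nu>
        then \<integral>\<^sup>+z. ennreal ((enn2real (RN_deriv \<mu> \<nu> z) - 1)\<^sup>2) \<partial>\<mu>
        else \<infinity>)"

text \<open>
  \<open>K\<close> is a (regular) conditional law of \<open>(A, B)\<close> given \<open>C\<close>.
\<close>

definition is_cond_law ::
    "'a measure \<Rightarrow> 'b measure \<Rightarrow> ('a \<Rightarrow> 'b) \<Rightarrow> 'c measure \<Rightarrow> ('a \<Rightarrow> 'c) \<Rightarrow> 'd measure \<Rightarrow> ('a \<Rightarrow> 'd) \<Rightarrow>
     ('d \<Rightarrow> ('b \<times> 'c) measure) \<Rightarrow> bool" where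
  "is_cond_law M S A T B U C K \<longleftrightarrow>
     K \<in> U \<rightarrow>\<^sub>M prob_algebra (S \<Otimes>\<^sub>M T) \<and>
     (\<forall>D\<in>sets U. \<forall>F\<in>sets (S \<Otimes>\<^sub>M T).
        emeasure M {\<omega> \<in> space M. C \<omega> \<in> D \<and> (A \<omega>, B \<omega>) \<in> F} =
        (\<integral>\<^sup>+c\<in>D. emeasure (K c) F \<partial>distr M U C))"

text \<open>
  Conditional chi-squared mutual information of \<open>A\<close> and \<open>B\<close> given \<open>C\<close>, for random variables with
  values in \<open>S\<close>, \<open>T\<close>, \<open>U\<close>. For finite-valued \<open>A\<close> and \<open>B\<close>, the only case used, a conditional law
  exists and any two of them agree for almost every value of \<open>C\<close>, so the choice is immaterial.
\<close>

definition cond_law ::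
    "'a measure \<Rightarrow> 'b measure \<Rightarrow> ('a \<Rightarrow> 'b) \<Rightarrow> 'c measure \<Rightarrow> ('a \<Rightarrow> 'c) \<Rightarrow> 'd measure \<Rightarrow> ('a \<Rightarrow> 'd) \<Rightarrow>
     'd \<Rightarrow> ('b \<times> 'c) measure" where
  "cond_law M S A T B U C = (SOME K. is_cond_law M S A T B U C K)"

definition cond_chi2_info ::
    "'a measure \<Rightarrow> 'b measure \<Rightarrow> ('a \<Rightarrow> 'b) \<Rightarrow> 'c measure \<Rightarrow> ('a \<Rightarrow> 'c) \<Rightarrow> 'd measure \<Rightarrow> ('a \<Rightarrow> 'd) \<Rightarrow>
     ennreal" where
  "cond_chi2_info M S A T B U C =
    (\<integral>\<^sup>+c. chi2_info S T (cond_law M S A T B U C c) \<partial>distr M U C)"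


section \<open>Spin synchronization\<close>

abbreviation spins :: "int measure" where
  "spins \<equiv> count_space {-1, 1}"

definition edge_spin :: "('e \<Rightarrow> 'v \<times> 'v) \<Rightarrow> ('v \<Rightarrow> int) \<Rightarrow> 'e \<Rightarrow> int" where
  "edge_spin ends x e = x (fst (ends e)) * x (snd (ends e))"

definition observations :: "('e \<Rightarrow> 'a \<Rightarrow> 'y) \<Rightarrow> 'e set \<Rightarrow> 'a \<Rightarrow> ('e \<Rightarrow> 'y)" where
  "observations Y S \<omega> = (\<lambda>e\<in>S. Y e \<omega>)"

text \<open>
  Each edge \<open>e\<close> has its own measurable output alphabet \<open>N e\<close> and its own channel \<open>Q e\<close> from spins
  to \<open>N e\<close>. For finite \<open>V\<close>, every event \<open>{X = x}\<close> has positive probability, so conditioning on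
  \<open>X = x\<close> is elementary; the conditional law of the observations is required to be the product of
  the channel outputs.
\<close>

definition spin_synchronization ::
    "('e \<Rightarrow> 'v \<times> 'v) \<Rightarrow> 'v set \<Rightarrow> 'e set \<Rightarrow> ('e \<Rightarrow> 'y measure) \<Rightarrow> ('e \<Rightarrow> int \<Rightarrow> 'y measure) \<Rightarrow>
     'a measure \<Rightarrow> ('v \<Rightarrow> 'a \<Rightarrow> int) \<Rightarrow> ('e \<Rightarrow> 'a \<Rightarrow> 'y) \<Rightarrow> bool" where
  "spin_synchronization ends V E N Q M X Y \<longleftrightarrow>
     finite_multigraph ends V E \<and>
     (\<forall>e\<in>E. Q e \<in> spins \<rightarrow>\<^sub>M prob_algebra (N e)) \<and>
     prob_space M \<and>
     prob_space.indep_vars M (\<lambda>_. spins) X V \<and>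
     (\<forall>w\<in>V. distr M spins (X w) = uniform_count_measure {-1, 1}) \<and>
     (\<forall>e\<in>E. Y e \<in> M \<rightarrow>\<^sub>M N e) \<and>
     (\<forall>x \<in> V \<rightarrow> {-1, 1}.
        distr (uniform_measure M {\<omega> \<in> space M. \<forall>w\<in>V. X w \<omega> = x w})
              (Pi\<^sub>M E N) (observations Y E) =
        Pi\<^sub>M E (\<lambda>e. Q e (edge_spin ends x e)))"

end

theory Submission
  imports Defs
begin

text \<open>
  Take the average \<open>\<mu>\<^sub>e\<close> of the two outputs of the channel of \<open>e\<close> as reference measure, so that the outputs
  have densities \<open>1 + s \<theta>\<^sub>e\<close> with \<open>\<bar>\<theta>\<^sub>e\<bar> \<le> 1\<close> and \<open>\<integral>\<theta>\<^sub>e d\<mu>\<^sub>e = 0\<close>. Averaging the likelihood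
  \<open>\<Prod>\<^sub>e (1 + x\<^sub>e \<theta>\<^sub>e)\<close> over all spin configurations \<open>x\<close>, without and with the factor \<open>x\<^sub>u x\<^sub>v\<close>, gives functions
  \<open>p\<close> and \<open>q\<close> of the observations. The law of the observations has density \<open>p\<close>, the conditional mean
  of \<open>X\<^sub>u X\<^sub>v\<close> is \<open>m = q / p\<close>, and since \<open>X\<^sub>u\<close> and \<open>X\<^sub>v\<close> stay uniform after conditioning (global spin flip),
  the information is \<open>\<integral>m\<^sup>2 p = \<integral>q\<^sup>2 / p\<close>. On a path \<open>p = 1\<close> and \<open>q = \<Prod>\<^sub>e \<theta>\<^sub>e\<close>, so the information is a
  product over the edges. A series composition multiplies the \<open>p\<close> and the \<open>q\<close>, hence the informations.
  A parallel composition has \<open>p = p\<^sub>1 p\<^sub>2 + q\<^sub>1 q\<^sub>2\<close> and \<open>q = p\<^sub>1 q\<^sub>2 + q\<^sub>1 p\<^sub>2\<close>; the information is at most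
  the sum of the two informations because
  \<open>(a + b)\<^sup>2 / (1 + a b) \<le> a\<^sup>2 + b\<^sup>2 + a b (2 - a\<^sup>2 - b\<^sup>2)\<close> for \<open>a, b \<in> [-1, 1]\<close>, where the mixed
  terms integrate to zero against \<open>p\<^sub>1 p\<^sub>2\<close> since \<open>\<integral>q\<^sub>1 = \<integral>q\<^sub>2 = 0\<close>.
\<close>

section \<open>Averages over spin configurations\<close>

text \<open>Extensional functions, so that there are finitely many configurations and each is
  determined by its values on \<open>V\<close>. For the same reason the global flip below is the
  restricted function \<open>\<lambda>i\<in>V. - x i\<close>.\<close>

definition spin_configs :: "'v set \<Rightarrow> ('v \<Rightarrow> int) set" where
  "spin_configs V = (\<Pi>\<^sub>E w\<in>V. {-1, 1})"

lemma finite_spin_configs [simp]: "finite V \<Longrightarrow> finite (spin_configs V)"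
  unfolding spin_configs_def by (rule finite_PiE) auto

lemma card_spin_configs: "finite V \<Longrightarrow> card (spin_configs V) = 2 ^ card V"
  unfolding spin_configs_def by (subst card_PiE) (auto simp: numeral_2_eq_2)

lemma spin_configs_cases:
  assumes "x \<in> spin_configs V" "w \<in> V"
  obtains "x w = -1" | "x w = 1"
  using assms unfolding spin_configs_def by auto

lemma spin_configs_flip: "x \<in> spin_configs V \<Longrightarrow> (\<lambda>i\<in>V. - x i) \<in> spin_configs V"
  unfolding spin_configs_def by (auto simp: PiE_iff)

lemma sum_spin_configs_flip:
  fixes f :: "('v \<Rightarrow> int) \<Rightarrow> real"
  shows "(\<Sum>x\<in>spin_configs V. f (\<lambda>i\<in>V. - x i)) = (\<Sum>x\<in>spin_configs V. f x)"
  by (rule sum.reindex_bij_witness[where i = "\<lambda>x. \<lambda>i\<in>V. - x i" and j = "\<lambda>x. \<lambda>i\<in>V. - x i"])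
     (auto simp: spin_configs_flip, auto simp: spin_configs_def fun_eq_iff PiE_iff extensional_def)

lemma sum_spin_configs_flip_vertex:
  fixes f :: "('v \<Rightarrow> int) \<Rightarrow> real"
  assumes "w \<in> V"
  shows "(\<Sum>x\<in>spin_configs V. f (x(w := - x w))) = (\<Sum>x\<in>spin_configs V. f x)"
  by (rule sum.reindex_bij_witness[where i = "\<lambda>x. x(w := - x w)" and j = "\<lambda>x. x(w := - x w)"])
     (use assms in \<open>auto simp: spin_configs_def PiE_iff extensional_def\<close>)

text \<open>The global flip is a bijection of the configurations that keeps \<open>f\<close> and
  negates the factor \<open>x w\<close>, so the sum equals its own negative. Likelihoods satisfy the
  hypothesis on \<open>f\<close> because they see spins only through products of two.\<close>

lemma sum_spin_configs_odd:
  fixes f :: "('v \<Rightarrow> int) \<Rightarrow> real"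
  assumes "w \<in> V" and "\<And>x. x \<in> spin_configs V \<Longrightarrow> f (\<lambda>i\<in>V. - x i) = f x"
  shows "(\<Sum>x\<in>spin_configs V. of_int (x w) * f x) = 0"
proof -
  have "(\<Sum>x\<in>spin_configs V. of_int (x w) * f x)
      = (\<Sum>x\<in>spin_configs V. of_int ((\<lambda>i\<in>V. - x i) w) * f (\<lambda>i\<in>V. - x i))"
    by (rule sum_spin_configs_flip[symmetric])
  also have "\<dots> = (\<Sum>x\<in>spin_configs V. - (of_int (x w) * f x))"
    using assms by (intro sum.cong) auto
  finally show ?thesis by (simp add: sum_negf)
qed

text \<open>The indicator of \<open>x w = s\<close> is \<open>(1 + s x\<^sub>w) / 2\<close>, and the odd term averages out.\<close>

lemma sum_fixed_spin:
  fixes f :: "('v \<Rightarrow> int) \<Rightarrow> real"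
  assumes "finite V" "w \<in> V" "s \<in> {-1, 1}"
    and flip: "\<And>x. x \<in> spin_configs V \<Longrightarrow> f (\<lambda>i\<in>V. - x i) = f x"
  shows "(\<Sum>x\<in>{x\<in>spin_configs V. x w = s}. f x) = (\<Sum>x\<in>spin_configs V. f x) / 2"
proof -
  have "(\<Sum>x\<in>{x\<in>spin_configs V. x w = s}. f x) = (\<Sum>x\<in>spin_configs V. if x w = s then f x else 0)"
    using assms(1) by (simp add: sum.inter_filter)
  also have "\<dots> = (\<Sum>x\<in>spin_configs V. f x / 2 + of_int s / 2 * (of_int (x w) * f x))"
  proof (intro sum.cong refl)
    fix x assume "x \<in> spin_configs V"
    then show "(if x w = s then f x else 0) = f x / 2 + of_int s / 2 * (of_int (x w) * f x)"
      using assms(2,3) by (elim spin_configs_cases) auto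
  qed
  also have "\<dots> = (\<Sum>x\<in>spin_configs V. f x) / 2"
    using sum_spin_configs_odd[of w V f] assms
    by (simp add: sum.distrib flip: sum_distrib_left sum_divide_distrib)
  finally show ?thesis .
qed

text \<open>The indicator of the two fixed spins is
  \<open>(1 + s * x u) * (1 + t * x v) / 4\<close>. Of its four terms, the two linear in a spin are
  odd under the global flip and drop out.\<close>

lemma sum_fixed_two_spins:
  fixes f :: "('v \<Rightarrow> int) \<Rightarrow> real"
  assumes "finite V" "u \<in> V" "v \<in> V" "s \<in> {-1, 1}" "t \<in> {-1, 1}"
    and flip: "\<And>x. x \<in> spin_configs V \<Longrightarrow> f (\<lambda>i\<in>V. - x i) = f x"
  shows "(\<Sum>x\<in>{x\<in>spin_configs V. x u = s \<and> x v = t}. f x) =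
    ((\<Sum>x\<in>spin_configs V. f x) + of_int (s * t) * (\<Sum>x\<in>spin_configs V. of_int (x u * x v) * f x)) / 4"
proof -
  have "(\<Sum>x\<in>{x\<in>spin_configs V. x u = s \<and> x v = t}. f x)
      = (\<Sum>x\<in>spin_configs V. if x u = s \<and> x v = t then f x else 0)"
    using assms(1) by (simp add: sum.inter_filter)
  also have "\<dots> = (\<Sum>x\<in>spin_configs V. f x / 4 + of_int (s * t) / 4 * (of_int (x u * x v) * f x)
      + of_int s / 4 * (of_int (x u) * f x) + of_int t / 4 * (of_int (x v) * f x))"
  proof (intro sum.cong refl)
    fix x assume x: "x \<in> spin_configs V"
    show "(if x u = s \<and> x v = t then f x else 0) =
      f x / 4 + of_int (s * t) / 4 * (of_int (x u * x v) * f x)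
      + of_int s / 4 * (of_int (x u) * f x) + of_int t / 4 * (of_int (x v) * f x)"
      by (rule spin_configs_cases[OF x \<open>u \<in> V\<close>]; rule spin_configs_cases[OF x \<open>v \<in> V\<close>])
         (use assms(4,5) in auto)
  qed
  also have "\<dots> = (\<Sum>x\<in>spin_configs V. f x) / 4
      + of_int (s * t) / 4 * (\<Sum>x\<in>spin_configs V. of_int (x u * x v) * f x)"
    using sum_spin_configs_odd[of u V f] sum_spin_configs_odd[of v V f] assms
    by (simp add: sum.distrib flip: sum_distrib_left sum_divide_distrib)
  finally show ?thesis by (simp add: add_divide_distrib)
qed

text \<open>A configuration on the union is a pair of configurations that agree on the overlap. Once
  the common restriction \<open>z\<close> is fixed, the two halves vary independently and the sum
  factors.\<close>

lemma sum_spin_configs_glue: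
  fixes f g :: "('v \<Rightarrow> int) \<Rightarrow> real"
  assumes "finite V1" "finite V2"
    and f: "\<And>x y. (\<And>i. i \<in> V1 \<Longrightarrow> x i = y i) \<Longrightarrow> f x = f y"
    and g: "\<And>x y. (\<And>i. i \<in> V2 \<Longrightarrow> x i = y i) \<Longrightarrow> g x = g y"
  shows "(\<Sum>x\<in>spin_configs (V1 \<union> V2). f x * g x) =
    (\<Sum>z\<in>spin_configs (V1 \<inter> V2).
      (\<Sum>x\<in>{x\<in>spin_configs V1. \<forall>i\<in>V1 \<inter> V2. x i = z i}. f x) *
      (\<Sum>x\<in>{x\<in>spin_configs V2. \<forall>i\<in>V1 \<inter> V2. x i = z i}. g x))"
proof -
  define A where "A W z = {x \<in> spin_configs W. \<forall>i\<in>V1 \<inter> V2. x i = z i}" for W and z :: "'v \<Rightarrow> int"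
  have fin: "finite (A V1 z)" "finite (A V2 z)" for z
    using assms(1,2) by (auto simp: A_def)
  have "(\<Sum>x\<in>spin_configs (V1 \<union> V2). f x * g x) =
      (\<Sum>(z, a, b)\<in>Sigma (spin_configs (V1 \<inter> V2)) (\<lambda>z. A V1 z \<times> A V2 z). f a * g b)"
  \<comment> \<open>The inverse map reads \<open>a\<close> first; on the overlap this is no real
    choice, since \<open>a\<close> and \<open>b\<close> both equal \<open>z\<close> there.\<close>
  proof (rule sum.reindex_bij_witness[where
        j = "\<lambda>x. (restrict x (V1 \<inter> V2), restrict x V1, restrict x V2)" and
        i = "\<lambda>(z, a, b). (\<lambda>i\<in>V1 \<union> V2. if i \<in> V1 then a i else b i)"])
    fix x assume x: "x \<in> spin_configs (V1 \<union> V2)"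
    show "(case (restrict x (V1 \<inter> V2), restrict x V1, restrict x V2) of
        (z, a, b) \<Rightarrow> \<lambda>i\<in>V1 \<union> V2. if i \<in> V1 then a i else b i) = x"
      using x by (auto simp: spin_configs_def PiE_iff extensional_def fun_eq_iff)
    show "(restrict x (V1 \<inter> V2), restrict x V1, restrict x V2)
        \<in> Sigma (spin_configs (V1 \<inter> V2)) (\<lambda>z. A V1 z \<times> A V2 z)"
      using x by (auto simp: spin_configs_def A_def PiE_iff)
    show "(case (restrict x (V1 \<inter> V2), restrict x V1, restrict x V2) of (z, a, b) \<Rightarrow> f a * g b) = f x * g x"
      by (auto intro!: arg_cong2[where f = "(*)"] f g)
  next
    fix y assume "y \<in> Sigma (spin_configs (V1 \<inter> V2)) (\<lambda>z. A V1 z \<times> A V2 z)"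
    then obtain z a b where y: "y = (z, a, b)" and z: "z \<in> spin_configs (V1 \<inter> V2)"
      and a: "a \<in> A V1 z" and b: "b \<in> A V2 z" by auto
    define x where "x = (\<lambda>i\<in>V1 \<union> V2. if i \<in> V1 then a i else b i)"
    have "restrict x (V1 \<inter> V2) = z" "restrict x V1 = a" "restrict x V2 = b"
      using z a b by (auto simp: x_def spin_configs_def A_def PiE_iff extensional_def fun_eq_iff)
    then show "(\<lambda>x. (restrict x (V1 \<inter> V2), restrict x V1, restrict x V2))
        (case y of (z, a, b) \<Rightarrow> \<lambda>i\<in>V1 \<union> V2. if i \<in> V1 then a i else b i) = y"
      by (simp add: y x_def)
    show "(case y of (z, a, b) \<Rightarrow> \<lambda>i\<in>V1 \<union> V2. if i \<in> V1 then a i else b i) \<in> spin_configs (V1 \<union> V2)"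
      using a b by (auto simp: y A_def spin_configs_def PiE_iff)
  qed
  also have "\<dots> = (\<Sum>z\<in>spin_configs (V1 \<inter> V2). \<Sum>(a, b)\<in>A V1 z \<times> A V2 z. f a * g b)"
    using assms(1) fin by (subst sum.Sigma[symmetric]) auto
  also have "\<dots> = (\<Sum>z\<in>spin_configs (V1 \<inter> V2). sum f (A V1 z) * sum g (A V2 z))"
    by (simp add: sum_product sum.cartesian_product)
  finally show ?thesis by (simp add: A_def)
qed

lemma sum_spin_configs_vertex:
  fixes h :: "int \<Rightarrow> real"
  shows "(\<Sum>z\<in>spin_configs {w}. h (z w)) = h (-1) + h 1"
proof -
  have "(\<Sum>z\<in>spin_configs {w}. h (z w)) = (\<Sum>s\<in>{-1, 1}. h s)"
    by (rule sum.reindex_bij_witness[where j = "\<lambda>z. z w" and i = "\<lambda>s. \<lambda>i\<in>{w}. s"])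
       (auto simp: spin_configs_def PiE_iff extensional_def fun_eq_iff)
  then show ?thesis by simp
qed

lemma sum_spin_configs_two_vertices:
  fixes h :: "int \<Rightarrow> int \<Rightarrow> real"
  assumes "u \<noteq> v"
  shows "(\<Sum>z\<in>spin_configs {u, v}. h (z u) (z v)) = h (-1) (-1) + h (-1) 1 + h 1 (-1) + h 1 1"
proof -
  have "(\<Sum>z\<in>spin_configs {u, v}. h (z u) (z v)) = (\<Sum>(s, t)\<in>{-1, 1} \<times> {-1, 1}. h s t)"
    by (rule sum.reindex_bij_witness[where j = "\<lambda>z. (z u, z v)" and
          i = "\<lambda>(s, t). \<lambda>i\<in>{u, v}. if i = u then s else t"])
       (use assms in \<open>auto simp: spin_configs_def PiE_iff extensional_def fun_eq_iff\<close>)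
  also have "\<dots> = h (-1) (-1) + h (-1) 1 + h 1 (-1) + h 1 1"
    by (subst sum.cartesian_product[symmetric]) simp
  finally show ?thesis .
qed

section \<open>Expectations under uniform spins and their behaviour under series and parallel
  gluing\<close>

definition spin_average :: "'v set \<Rightarrow> (('v \<Rightarrow> int) \<Rightarrow> real) \<Rightarrow> real" where
  "spin_average V f = (\<Sum>x\<in>spin_configs V. f x) / 2 ^ card V"

text \<open>By flip invariance, fixing the shared spin to either value keeps exactly half of each
  sum. The two values together contribute half of the product of the full sums, and the
  normalisations absorb this factor.\<close>

lemma spin_average_series:
  assumes "finite V1" "finite V2" "V1 \<inter> V2 = {w}"
    and f: "\<And>x y. (\<And>i. i \<in> V1 \<Longrightarrow> x i = y i) \<Longrightarrow> f x = f y"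
    and g: "\<And>x y. (\<And>i. i \<in> V2 \<Longrightarrow> x i = y i) \<Longrightarrow> g x = g y"
    and f_flip: "\<And>x. x \<in> spin_configs V1 \<Longrightarrow> f (\<lambda>i\<in>V1. - x i) = f x"
    and g_flip: "\<And>x. x \<in> spin_configs V2 \<Longrightarrow> g (\<lambda>i\<in>V2. - x i) = g x"
  shows "spin_average (V1 \<union> V2) (\<lambda>x. f x * g x) = spin_average V1 f * spin_average V2 g"
proof -
  have w: "w \<in> V1" "w \<in> V2" using assms(3) by auto
  have 1: "(\<Sum>x\<in>{x\<in>spin_configs V1. x w = s}. f x) = (\<Sum>x\<in>spin_configs V1. f x) / 2"
    if "s \<in> {-1, 1}" for s
    by (rule sum_fixed_spin) (use assms(1,2) w that in \<open>auto simp: f_flip g_flip\<close>)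
  have 2: "(\<Sum>x\<in>{x\<in>spin_configs V2. x w = s}. g x) = (\<Sum>x\<in>spin_configs V2. g x) / 2"
    if "s \<in> {-1, 1}" for s
    by (rule sum_fixed_spin) (use assms(1,2) w that in \<open>auto simp: f_flip g_flip\<close>)
  have "(\<Sum>x\<in>spin_configs (V1 \<union> V2). f x * g x) =
    (\<Sum>z\<in>spin_configs {w}. (\<Sum>x\<in>{x\<in>spin_configs V1. x w = z w}. f x) *
      (\<Sum>x\<in>{x\<in>spin_configs V2. x w = z w}. g x))"
    using sum_spin_configs_glue[of V1 V2 f g, OF assms(1,2) f g] by (simp add: assms(3))
  also have "\<dots> = (\<Sum>x\<in>spin_configs V1. f x) * (\<Sum>x\<in>spin_configs V2. g x) / 2"
    by (subst sum_spin_configs_vertex[where h = "\<lambda>s. (\<Sum>x\<in>{x\<in>spin_configs V1. x w = s}. f x) *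
      (\<Sum>x\<in>{x\<in>spin_configs V2. x w = s}. g x)"]) (simp add: 1 2)
  finally have *: "(\<Sum>x\<in>spin_configs (V1 \<union> V2). f x * g x) =
    (\<Sum>x\<in>spin_configs V1. f x) * (\<Sum>x\<in>spin_configs V2. g x) / 2" .
  \<comment> \<open>The shared vertex is counted twice, so the two normalisations multiply to twice
    that of the union.\<close>
  have "card V1 + card V2 = Suc (card (V1 \<union> V2))"
    using card_Un_Int[OF assms(1,2)] by (simp add: assms(3))
  then have "(2::real) ^ card V1 * 2 ^ card V2 = 2 * 2 ^ card (V1 \<union> V2)"
    by (simp flip: power_add)
  then show ?thesis unfolding spin_average_def * by (simp add: field_simps)
qed

text \<open>Fixing the shared spins to \<open>s\<close> and \<open>t\<close> turns the two sums into
  \<open>(A + s t A') / 4\<close> and \<open>(B + s t B') / 4\<close>. In the sum of their product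
  over the four sign pairs the terms with a single factor \<open>s t\<close> cancel. The lemma
  yields the composition rules for both \<open>evidence\<close> and
  \<open>correlation\<close>.\<close>

lemma spin_average_parallel:
  assumes "finite V1" "finite V2" "V1 \<inter> V2 = {u, v}" "u \<noteq> v"
    and f: "\<And>x y. (\<And>i. i \<in> V1 \<Longrightarrow> x i = y i) \<Longrightarrow> f x = f y"
    and g: "\<And>x y. (\<And>i. i \<in> V2 \<Longrightarrow> x i = y i) \<Longrightarrow> g x = g y"
    and f_flip: "\<And>x. x \<in> spin_configs V1 \<Longrightarrow> f (\<lambda>i\<in>V1. - x i) = f x"
    and g_flip: "\<And>x. x \<in> spin_configs V2 \<Longrightarrow> g (\<lambda>i\<in>V2. - x i) = g x"
  shows "spin_average (V1 \<union> V2) (\<lambda>x. f x * g x) = spin_average V1 f * spin_average V2 g +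
    spin_average V1 (\<lambda>x. of_int (x u * x v) * f x) * spin_average V2 (\<lambda>x. of_int (x u * x v) * g x)"
proof -
  have w: "u \<in> V1" "u \<in> V2" "v \<in> V1" "v \<in> V2" using assms(3) by auto
  define A where "A = (\<Sum>x\<in>spin_configs V1. f x)"
  define A' where "A' = (\<Sum>x\<in>spin_configs V1. of_int (x u * x v) * f x)"
  define B where "B = (\<Sum>x\<in>spin_configs V2. g x)"
  define B' where "B' = (\<Sum>x\<in>spin_configs V2. of_int (x u * x v) * g x)"
  have 1: "(\<Sum>x\<in>{x\<in>spin_configs V1. x u = s \<and> x v = t}. f x) = (A + of_int (s * t) * A') / 4"
    if "s \<in> {-1, 1}" "t \<in> {-1, 1}" for s t
    unfolding A_def A'_def by (rule sum_fixed_two_spins) (use assms(1,2) w that in \<open>auto simp: f_flip g_flip\<close>)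
  have 2: "(\<Sum>x\<in>{x\<in>spin_configs V2. x u = s \<and> x v = t}. g x) = (B + of_int (s * t) * B') / 4"
    if "s \<in> {-1, 1}" "t \<in> {-1, 1}" for s t
    unfolding B_def B'_def by (rule sum_fixed_two_spins) (use assms(1,2) w that in \<open>auto simp: f_flip g_flip\<close>)
  have "(\<Sum>x\<in>spin_configs (V1 \<union> V2). f x * g x) =
    (\<Sum>z\<in>spin_configs {u, v}. (\<Sum>x\<in>{x\<in>spin_configs V1. x u = z u \<and> x v = z v}. f x) *
      (\<Sum>x\<in>{x\<in>spin_configs V2. x u = z u \<and> x v = z v}. g x))"
    using sum_spin_configs_glue[of V1 V2 f g, OF assms(1,2) f g] by (simp add: assms(3))
  also have "\<dots> = (A * B + A' * B') / 4"
    by (subst sum_spin_configs_two_vertices[OF assms(4), where h = "\<lambda>s t.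
      (\<Sum>x\<in>{x\<in>spin_configs V1. x u = s \<and> x v = t}. f x) *
      (\<Sum>x\<in>{x\<in>spin_configs V2. x u = s \<and> x v = t}. g x)"]) (simp add: 1 2 field_simps)
  finally have *: "(\<Sum>x\<in>spin_configs (V1 \<union> V2). f x * g x) = (A * B + A' * B') / 4" .
  have "card V1 + card V2 = Suc (Suc (card (V1 \<union> V2)))"
    using card_Un_Int[OF assms(1,2)] assms(4) by (simp add: assms(3))
  then have "(2::real) ^ card V1 * 2 ^ card V2 = 4 * 2 ^ card (V1 \<union> V2)"
    by (simp flip: power_add)
  then show ?thesis
    unfolding spin_average_def * A_def[symmetric] A'_def[symmetric] B_def[symmetric] B'_def[symmetric]
    by (simp add: field_simps)
qed

lemma spin_average_const [simp]: "finite V \<Longrightarrow> spin_average V (\<lambda>_. c) = c"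
  by (simp add: spin_average_def card_spin_configs)

text \<open>Here one spin is flipped alone, in contrast to the global flip above; this detects a
  spin that occurs an odd number of times.\<close>

lemma spin_average_vertex_odd:
  assumes "w \<in> V" "\<And>x. x \<in> spin_configs V \<Longrightarrow> f (x(w := - x w)) = - f x"
  shows "spin_average V f = 0"
proof -
  have "(\<Sum>x\<in>spin_configs V. f x) = (\<Sum>x\<in>spin_configs V. - f x)"
    using sum_spin_configs_flip_vertex[OF assms(1), of f] assms(2) by simp
  then show ?thesis by (simp add: spin_average_def sum_negf)
qed

lemma spin_average_cong: "(\<And>x. x \<in> spin_configs V \<Longrightarrow> f x = g x) \<Longrightarrow> spin_average V f = spin_average V g"
  by (simp add: spin_average_def)

lemma spin_average_add: "spin_average V (\<lambda>x. f x + g x) = spin_average V f + spin_average V g"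
  by (simp add: spin_average_def sum.distrib add_divide_distrib)

lemma spin_average_cmult: "spin_average V (\<lambda>x. c * f x) = c * spin_average V f"
  by (simp add: spin_average_def sum_distrib_left)

lemma spin_average_mono:
  "(\<And>x. x \<in> spin_configs V \<Longrightarrow> f x \<le> g x) \<Longrightarrow> spin_average V f \<le> spin_average V g"
  by (simp add: spin_average_def sum_mono divide_right_mono)

lemma spin_average_abs: "\<bar>spin_average V f\<bar> \<le> spin_average V (\<lambda>x. \<bar>f x\<bar>)"
  by (simp add: spin_average_def abs_divide divide_right_mono)


section \<open>Likelihoods of edge observations\<close>

text \<open>For \<open>B\<close> as defined in the proof, \<open>(1 + m1 * m2) * B\<close> exceeds
  \<open>(m1 + m2)\<^sup>2\<close> by
  \<open>m1\<^sup>2 * m2\<^sup>2 * (2 - m1\<^sup>2 - m2\<^sup>2)\<close>, which is nonnegative. The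
  bound is scaled by \<open>p1 * p2\<close> and expanded so that each term is a function of the
  first part times a function of the second, ready for termwise integration.\<close>

lemma parallel_composition_bound:
  fixes p1 p2 q1 q2 m1 m2 :: real
  assumes p: "0 \<le> p1" "0 \<le> p2" and m: "\<bar>m1\<bar> \<le> 1" "\<bar>m2\<bar> \<le> 1"
    and q: "q1 = p1 * m1" "q2 = p2 * m2"
  shows "(p1 * q2 + q1 * p2)\<^sup>2 / (p1 * p2 + q1 * q2) \<le>
    (q1 * m1) * p2 + p1 * (q2 * m2) + 2 * (q1 * q2) - (q1 * m1\<^sup>2) * q2 - q1 * (q2 * m2\<^sup>2)"
proof -
  define P where "P = p1 * p2"
  define B where "B = m1\<^sup>2 + m2\<^sup>2 + m1 * m2 * (2 - m1\<^sup>2 - m2\<^sup>2)"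
  have "0 \<le> P" using p by (simp add: P_def)
  have sq: "m1\<^sup>2 \<le> 1" "m2\<^sup>2 \<le> 1" using m by (simp_all add: abs_square_le_1)
  have ab: "\<bar>m1 * m2\<bar> \<le> 1" using m by (simp add: abs_mult mult_le_one)
  have "0 \<le> m1\<^sup>2 * m2\<^sup>2 * (2 - m1\<^sup>2 - m2\<^sup>2)" using sq by simp
  moreover have "(1 + m1 * m2) * B = (m1 + m2)\<^sup>2 + m1\<^sup>2 * m2\<^sup>2 * (2 - m1\<^sup>2 - m2\<^sup>2)"
    by (simp add: B_def power2_eq_square algebra_simps)
  ultimately have key: "(m1 + m2)\<^sup>2 \<le> (1 + m1 * m2) * B" by linarith
  have "(p1 * q2 + q1 * p2)\<^sup>2 / (p1 * p2 + q1 * q2) = (P * (m1 + m2))\<^sup>2 / (P * (1 + m1 * m2))"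
    by (simp add: P_def q power2_eq_square algebra_simps)
  also have "\<dots> = P * ((m1 + m2)\<^sup>2 / (1 + m1 * m2))"
    by (simp add: power2_eq_square)
  also have "\<dots> \<le> P * B"
  proof (cases "1 + m1 * m2 = 0")
    \<comment> \<open>The quotient is 0 by convention, so only \<open>0 \<le> B\<close> is at stake;
      it follows from expanding the square of \<open>m1 + m2\<close> with
      \<open>m1 * m2 = -1\<close>.\<close>
    case True
    have "m1 * m2 = -1" using True by simp
    then have "B = 2 * (m1\<^sup>2 + m2\<^sup>2 - 1)" by (simp add: B_def)
    moreover have "0 \<le> (m1 + m2)\<^sup>2" by simp
    then have "2 \<le> m1\<^sup>2 + m2\<^sup>2" using \<open>m1 * m2 = -1\<close> by (simp add: power2_sum)
    ultimately have "0 \<le> B" by simp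
    then show ?thesis using True \<open>0 \<le> P\<close> by simp
  next
    case False
    then have "0 < 1 + m1 * m2" using ab by linarith
    then have "(m1 + m2)\<^sup>2 / (1 + m1 * m2) \<le> B" using key by (simp add: divide_le_eq mult.commute)
    then show ?thesis using \<open>0 \<le> P\<close> by (rule mult_left_mono)
  qed
  also have "P * B = (q1 * m1) * p2 + p1 * (q2 * m2) + 2 * (q1 * q2) - (q1 * m1\<^sup>2) * q2 - q1 * (q2 * m2\<^sup>2)"
    by (simp add: P_def B_def q power2_eq_square algebra_simps)
  finally show ?thesis .
qed

text \<open>The bound on \<theta> makes the densities \<open>1 + \<theta>\<close> and
  \<open>1 - \<theta>\<close> nonnegative, and the vanishing integral normalises them. The
  conditions range over all edge names, so that one product space over \<open>UNIV\<close> serves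
  every edge set.\<close>

locale edge_likelihoods =
  fixes ends :: "'e \<Rightarrow> 'v \<times> 'v" and \<mu> :: "'e \<Rightarrow> 'y measure" and \<theta> :: "'e \<Rightarrow> 'y \<Rightarrow> real"
  assumes prob_space_\<mu>: "\<And>e. prob_space (\<mu> e)"
    and measurable_\<theta> [measurable]: "\<And>e. \<theta> e \<in> borel_measurable (\<mu> e)"
    and \<theta>_le_1: "\<And>e y. \<bar>\<theta> e y\<bar> \<le> 1"
    and integral_\<theta>: "\<And>e. (\<integral>y. \<theta> e y \<partial>\<mu> e) = 0"
begin

sublocale product_prob_space \<mu> UNIV
proof (unfold product_prob_space_def product_prob_space_axioms_def product_sigma_finite_def, intro conjI allI)
  show "prob_space (\<mu> e)" for e by (rule prob_space_\<mu>)
  then show "sigma_finite_measure (\<mu> e)" for e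
    by (simp add: prob_space_imp_sigma_finite)
qed

section \<open>Bounded functions of the observations on a set of edges\<close>

lemma prob_space_Pi: "prob_space (Pi\<^sub>M S \<mu>)"
  by (rule prob_space_PiM) (rule prob_space_\<mu>)

text \<open>Functions act on full families of observations, and measurability is asked for every
  larger index set. The same function can then be integrated over the edges of a part or of the
  whole graph without inserting restriction maps. Boundedness gives integrability, as all measures
  are probability measures.\<close>

definition local_fun :: "'e set \<Rightarrow> (('e \<Rightarrow> 'y) \<Rightarrow> real) \<Rightarrow> bool" where
  "local_fun S F \<longleftrightarrow> (\<forall>y y'. (\<forall>e\<in>S. y e = y' e) \<longrightarrow> F y = F y') \<and>
    (\<forall>T. S \<subseteq> T \<longrightarrow> F \<in> borel_measurable (Pi\<^sub>M T \<mu>)) \<and> (\<exists>C. \<forall>y. \<bar>F y\<bar> \<le> C)"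

lemma local_funD:
  assumes "local_fun S F"
  shows "(\<And>e. e \<in> S \<Longrightarrow> y e = y' e) \<Longrightarrow> F y = F y'"
    and "S \<subseteq> T \<Longrightarrow> F \<in> borel_measurable (Pi\<^sub>M T \<mu>)"
    and "\<exists>C. \<forall>y. \<bar>F y\<bar> \<le> C"
  using assms unfolding local_fun_def by blast+

lemma local_fun_mono: "local_fun S F \<Longrightarrow> S \<subseteq> T \<Longrightarrow> local_fun T F"
  unfolding local_fun_def by (meson order_trans subsetD)

lemma local_fun_const: "local_fun S (\<lambda>_. c)"
  unfolding local_fun_def by auto

lemma local_fun_add:
  assumes "local_fun S F" "local_fun S G" shows "local_fun S (\<lambda>y. F y + G y)"
proof -
  obtain C D where "\<And>y. \<bar>F y\<bar> \<le> C" "\<And>y. \<bar>G y\<bar> \<le> D" using assms[THEN local_funD(3)] by blast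
  then have "\<bar>F y + G y\<bar> \<le> C + D" for y by (meson abs_triangle_ineq add_mono order_trans)
  then show ?thesis
    unfolding local_fun_def
  proof (intro conjI allI impI exI)
    show "F y + G y = F y' + G y'" if "\<forall>e\<in>S. y e = y' e" for y y'
      using local_funD(1)[OF assms(1), where y = y and y' = y']
        local_funD(1)[OF assms(2), where y = y and y' = y'] that by simp
    show "(\<lambda>y. F y + G y) \<in> borel_measurable (Pi\<^sub>M T \<mu>)" if "S \<subseteq> T" for T
      by (intro borel_measurable_add local_funD(2)[OF assms(1) that] local_funD(2)[OF assms(2) that])
  qed
qed

lemma local_fun_mult:
  assumes "local_fun S F" "local_fun S G" shows "local_fun S (\<lambda>y. F y * G y)"
proof -
  obtain C D where "\<And>y. \<bar>F y\<bar> \<le> C" "\<And>y. \<bar>G y\<bar> \<le> D" using assms[THEN local_funD(3)] by blast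
  then have "\<bar>F y * G y\<bar> \<le> C * D" for y
    unfolding abs_mult by (meson abs_ge_zero mult_mono order_trans)
  then show ?thesis
    unfolding local_fun_def
  proof (intro conjI allI impI exI)
    show "F y * G y = F y' * G y'" if "\<forall>e\<in>S. y e = y' e" for y y'
      using local_funD(1)[OF assms(1), where y = y and y' = y']
        local_funD(1)[OF assms(2), where y = y and y' = y'] that by simp
    show "(\<lambda>y. F y * G y) \<in> borel_measurable (Pi\<^sub>M T \<mu>)" if "S \<subseteq> T" for T
      by (intro borel_measurable_times local_funD(2)[OF assms(1) that] local_funD(2)[OF assms(2) that])
  qed
qed

lemma local_fun_sum: "(\<And>i. i \<in> I \<Longrightarrow> local_fun S (F i)) \<Longrightarrow> local_fun S (\<lambda>y. \<Sum>i\<in>I. F i y)"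
  by (induction I rule: infinite_finite_induct) (auto intro!: local_fun_const local_fun_add)

lemma local_fun_prod: "(\<And>i. i \<in> I \<Longrightarrow> local_fun S (F i)) \<Longrightarrow> local_fun S (\<lambda>y. \<Prod>i\<in>I. F i y)"
  by (induction I rule: infinite_finite_induct) (auto intro!: local_fun_const local_fun_mult)

lemma local_fun_\<theta>: "e \<in> S \<Longrightarrow> local_fun S (\<lambda>y. \<theta> e (y e))"
  unfolding local_fun_def using \<theta>_le_1 by auto

lemma integrable_local_fun: "local_fun S F \<Longrightarrow> S \<subseteq> T \<Longrightarrow> integrable (Pi\<^sub>M T \<mu>) F"
proof -
  assume F: "local_fun S F" "S \<subseteq> T"
  interpret T: prob_space "Pi\<^sub>M T \<mu>" by (rule prob_space_Pi)
  obtain C where "\<And>y. \<bar>F y\<bar> \<le> C" using local_funD(3)[OF F(1)] by blast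
  then show "integrable (Pi\<^sub>M T \<mu>) F"
    by (intro T.integrable_const_bound[where B = C]) (auto simp: local_funD(2)[OF F])
qed

text \<open>Independence of the observations on disjoint edge sets: after Fubini, \<open>F\<close>
  reads only the first component of the merged family and \<open>G\<close> only the second.\<close>

lemma integral_local_fun_mult:
  assumes "finite S" "finite T" "S \<inter> T = {}" and F: "local_fun S F" and G: "local_fun T G"
  shows "(\<integral>y. F y * G y \<partial>Pi\<^sub>M (S \<union> T) \<mu>) = (\<integral>y. F y \<partial>Pi\<^sub>M S \<mu>) * (\<integral>y. G y \<partial>Pi\<^sub>M T \<mu>)"
proof -
  have "local_fun (S \<union> T) (\<lambda>y. F y * G y)"
    by (intro local_fun_mult local_fun_mono[OF F] local_fun_mono[OF G]) auto
  then have "(\<integral>y. F y * G y \<partial>Pi\<^sub>M (S \<union> T) \<mu>) =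
      (\<integral>x. (\<integral>y. F (merge S T (x, y)) * G (merge S T (x, y)) \<partial>Pi\<^sub>M T \<mu>) \<partial>Pi\<^sub>M S \<mu>)"
    by (intro product_integral_fold assms integrable_local_fun) auto
  also have "\<dots> = (\<integral>x. (\<integral>y. F x * G y \<partial>Pi\<^sub>M T \<mu>) \<partial>Pi\<^sub>M S \<mu>)"
  proof -
    have "F (merge S T (x, y)) = F x" for x y
      by (rule local_funD(1)[OF F]) (simp add: merge_def)
    moreover have "G (merge S T (x, y)) = G y" for x y
      by (rule local_funD(1)[OF G]) (use assms(3) in \<open>auto simp: merge_def\<close>)
    ultimately show ?thesis by simp
  qed
  finally show ?thesis by simp
qed

section \<open>Likelihood, evidence and correlation\<close>

definition likelihood :: "'e set \<Rightarrow> ('e \<Rightarrow> 'y) \<Rightarrow> ('v \<Rightarrow> int) \<Rightarrow> real" where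
  "likelihood S y x = (\<Prod>e\<in>S. 1 + of_int (edge_spin ends x e) * \<theta> e (y e))"

text \<open>This is the \<open>p\<close> of the overview, and \<open>correlation\<close> is its
  \<open>q\<close>. The vertex set is a separate parameter and may contain vertices that no edge of
  \<open>S\<close> meets, so that observations along a path can be treated inside the whole
  graph.\<close>

definition evidence :: "'v set \<Rightarrow> 'e set \<Rightarrow> ('e \<Rightarrow> 'y) \<Rightarrow> real" where
  "evidence V S y = spin_average V (likelihood S y)"

definition correlation :: "'v set \<Rightarrow> 'e set \<Rightarrow> 'v \<Rightarrow> 'v \<Rightarrow> ('e \<Rightarrow> 'y) \<Rightarrow> real" where
  "correlation V S u v y = spin_average V (\<lambda>x. of_int (x u * x v) * likelihood S y x)"

text \<open>
  Where the evidence vanishes, so does the correlation, and the convention \<open>0 / 0 = 0\<close> for the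
  posterior mean is harmless.
\<close>

definition posterior :: "'v set \<Rightarrow> 'e set \<Rightarrow> 'v \<Rightarrow> 'v \<Rightarrow> ('e \<Rightarrow> 'y) \<Rightarrow> real" where
  "posterior V S u v y = correlation V S u v y / evidence V S y"

text \<open>The value of the conditional chi-squared information of the two end spins, as
  \<open>cond_chi2_info_eq_information\<close> confirms.\<close>

definition information :: "'v set \<Rightarrow> 'e set \<Rightarrow> 'v \<Rightarrow> 'v \<Rightarrow> real" where
  "information V S u v = (\<integral>y. (correlation V S u v y)\<^sup>2 / evidence V S y \<partial>Pi\<^sub>M S \<mu>)"

lemma likelihood_cong:
  assumes "ends ` S \<subseteq> W \<times> W" "\<And>i. i \<in> W \<Longrightarrow> x i = x' i"
  shows "likelihood S y x = likelihood S y x'"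
proof -
  have "edge_spin ends x e = edge_spin ends x' e" if "e \<in> S" for e
    using assms(1) that assms(2) by (cases "ends e") (force simp: edge_spin_def)
  then show ?thesis unfolding likelihood_def by (intro prod.cong) auto
qed

text \<open>An edge spin is a product of two spins, so the two signs cancel.\<close>

lemma likelihood_flip:
  assumes "ends ` S \<subseteq> V \<times> V"
  shows "likelihood S y (\<lambda>i\<in>V. - x i) = likelihood S y x"
proof -
  have "edge_spin ends (\<lambda>i\<in>V. - x i) e = edge_spin ends x e" if "e \<in> S" for e
    using assms(1) that by (cases "ends e") (force simp: edge_spin_def)
  then show ?thesis unfolding likelihood_def by (intro prod.cong) auto
qed

lemma likelihood_Un:
  "finite S \<Longrightarrow> finite T \<Longrightarrow> S \<inter> T = {} \<Longrightarrow> likelihood (S \<union> T) y x = likelihood S y x * likelihood T y x"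
  unfolding likelihood_def by (rule prod.union_disjoint)

lemma edge_spin_cases:
  assumes "ends e \<in> V \<times> V" "x \<in> spin_configs V"
  shows "edge_spin ends x e \<in> {-1, 1}"
proof -
  obtain a b where ab: "ends e = (a, b)" "a \<in> V" "b \<in> V" using assms(1) by auto
  show ?thesis
    by (rule spin_configs_cases[OF assms(2) \<open>a \<in> V\<close>]; rule spin_configs_cases[OF assms(2) \<open>b \<in> V\<close>])
       (auto simp: edge_spin_def ab)
qed

lemma likelihood_nonneg:
  assumes "ends ` S \<subseteq> V \<times> V" "x \<in> spin_configs V"
  shows "0 \<le> likelihood S y x"
  unfolding likelihood_def
proof (rule prod_nonneg)
  fix e assume "e \<in> S"
  then have "edge_spin ends x e \<in> {-1, 1}" using assms by (intro edge_spin_cases) auto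
  then show "0 \<le> 1 + of_int (edge_spin ends x e) * \<theta> e (y e)"
    using \<theta>_le_1[of e "y e"] by auto
qed

lemma evidence_nonneg:
  assumes "ends ` S \<subseteq> V \<times> V"
  shows "0 \<le> evidence V S y"
  unfolding evidence_def spin_average_def
  by (intro divide_nonneg_nonneg sum_nonneg likelihood_nonneg[OF assms]) auto

text \<open>Triangle inequality: likelihoods are nonnegative and the factor \<open>x u * x v\<close>
  has absolute value 1. In particular the correlation vanishes wherever the evidence does.\<close>

lemma abs_correlation_le:
  assumes "ends ` S \<subseteq> V \<times> V" "u \<in> V" "v \<in> V"
  shows "\<bar>correlation V S u v y\<bar> \<le> evidence V S y"
proof -
  have "\<bar>correlation V S u v y\<bar> \<le> spin_average V (\<lambda>x. \<bar>of_int (x u * x v) * likelihood S y x\<bar>)"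
    unfolding correlation_def by (rule spin_average_abs)
  also have "\<dots> \<le> evidence V S y"
    unfolding evidence_def
  proof (rule spin_average_mono)
    fix x assume x: "x \<in> spin_configs V"
    have L: "0 \<le> likelihood S y x" using assms x by (intro likelihood_nonneg)
    show "\<bar>of_int (x u * x v) * likelihood S y x\<bar> \<le> likelihood S y x"
      by (rule spin_configs_cases[OF x \<open>u \<in> V\<close>]; rule spin_configs_cases[OF x \<open>v \<in> V\<close>])
         (use L in auto)
  qed
  finally show ?thesis .
qed

lemma abs_posterior_le_1:
  assumes "ends ` S \<subseteq> V \<times> V" "u \<in> V" "v \<in> V"
  shows "\<bar>posterior V S u v y\<bar> \<le> 1"
  using abs_correlation_le[OF assms, of y] evidence_nonneg[OF assms(1), of y]
  by (auto simp: posterior_def abs_divide divide_le_eq_1)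

lemma correlation_eq_posterior:
  assumes "ends ` S \<subseteq> V \<times> V" "u \<in> V" "v \<in> V"
  shows "correlation V S u v y = evidence V S y * posterior V S u v y"
  using abs_correlation_le[OF assms, of y] by (cases "evidence V S y = 0") (auto simp: posterior_def)

lemma information_eq_posterior:
  "information V S u v = (\<integral>y. correlation V S u v y * posterior V S u v y \<partial>Pi\<^sub>M S \<mu>)"
  by (simp add: information_def posterior_def power2_eq_square)

lemma local_fun_likelihood: "local_fun S (\<lambda>y. likelihood S y x)"
  unfolding likelihood_def
  by (intro local_fun_prod local_fun_add local_fun_mult local_fun_const local_fun_\<theta>)

lemma local_fun_evidence: "local_fun S (evidence V S)"
  unfolding evidence_def spin_average_def divide_inverse
  by (intro local_fun_mult local_fun_sum local_fun_const local_fun_likelihood)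

lemma local_fun_correlation: "local_fun S (correlation V S u v)"
  unfolding correlation_def spin_average_def divide_inverse
  by (intro local_fun_mult local_fun_sum local_fun_const local_fun_likelihood)

lemma local_fun_posterior:
  assumes "ends ` S \<subseteq> V \<times> V" "u \<in> V" "v \<in> V"
  shows "local_fun S (posterior V S u v)"
  unfolding local_fun_def
proof (intro conjI allI impI exI)
  show "posterior V S u v y = posterior V S u v y'" if "\<forall>e\<in>S. y e = y' e" for y y'
    unfolding posterior_def
    by (rule arg_cong2[where f = "(/)"]; rule local_funD(1)[OF local_fun_correlation] local_funD(1)[OF local_fun_evidence])
       (use that in auto)
  show "posterior V S u v \<in> borel_measurable (Pi\<^sub>M T \<mu>)" if "S \<subseteq> T" for T
    unfolding posterior_def
    by (intro borel_measurable_divide local_funD(2)[OF local_fun_evidence]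
        local_funD(2)[OF local_fun_correlation] that)
  show "\<bar>posterior V S u v y\<bar> \<le> 1" for y by (rule abs_posterior_le_1[OF assms])
qed

section \<open>Integrals under the reference measure\<close>

lemma integral_likelihood:
  assumes "finite S" shows "(\<integral>y. likelihood S y x \<partial>Pi\<^sub>M S \<mu>) = 1"
proof -
  have i: "integrable (\<mu> e) (\<theta> e)" for e
    by (rule M.integrable_const_bound[where B = 1]) (auto simp: \<theta>_le_1)
  have "(\<integral>y. likelihood S y x \<partial>Pi\<^sub>M S \<mu>)
      = (\<Prod>e\<in>S. \<integral>y. 1 + of_int (edge_spin ends x e) * \<theta> e y \<partial>\<mu> e)"
    unfolding likelihood_def by (intro product_integral_prod assms Bochner_Integration.integrable_add integrable_mult_right M.integrable_const i)
  also have "\<dots> = 1" by (simp add: i integral_\<theta> M.prob_space)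
  finally show ?thesis .
qed

lemma integral_evidence:
  assumes "finite V" "finite S" shows "(\<integral>y. evidence V S y \<partial>Pi\<^sub>M S \<mu>) = 1"
proof -
  have "(\<integral>y. evidence V S y \<partial>Pi\<^sub>M S \<mu>) = (\<Sum>x\<in>spin_configs V. \<integral>y. likelihood S y x \<partial>Pi\<^sub>M S \<mu>) / 2 ^ card V"
    unfolding evidence_def spin_average_def
    by (simp add: Bochner_Integration.integral_sum integrable_local_fun[OF local_fun_likelihood])
  then show ?thesis using assms by (simp add: integral_likelihood card_spin_configs)
qed

text \<open>Integrating out the observations turns each likelihood into 1. What remains is the prior
  mean of \<open>x u * x v\<close>, which is odd in the spin of \<open>u\<close> because
  \<open>u\<close> and \<open>v\<close> differ.\<close>

lemma integral_correlation:
  assumes "finite V" "finite S" "u \<in> V" "u \<noteq> v"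
  shows "(\<integral>y. correlation V S u v y \<partial>Pi\<^sub>M S \<mu>) = 0"
proof -
  have "(\<integral>y. correlation V S u v y \<partial>Pi\<^sub>M S \<mu>) = spin_average V (\<lambda>x. of_int (x u * x v))"
    using assms(2) unfolding correlation_def spin_average_def
    by (simp add: Bochner_Integration.integral_sum integrable_local_fun[OF local_fun_likelihood]
        integral_likelihood)
  also have "\<dots> = 0"
    using assms by (intro spin_average_vertex_odd) auto
  finally show ?thesis .
qed

section \<open>Information of series and parallel compositions\<close>

lemma information_series:
  assumes "finite V1" "finite V2" "finite S1" "finite S2" "V1 \<inter> V2 = {w}" "S1 \<inter> S2 = {}"
    and e1: "ends ` S1 \<subseteq> V1 \<times> V1" and e2: "ends ` S2 \<subseteq> V2 \<times> V2"
    and "u \<in> V1" "v \<in> V2"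
  shows "information (V1 \<union> V2) (S1 \<union> S2) u v = information V1 S1 u w * information V2 S2 w v"
proof -
  have w: "w \<in> V1" "w \<in> V2" using assms(5) by auto
  have p: "evidence (V1 \<union> V2) (S1 \<union> S2) y = evidence V1 S1 y * evidence V2 S2 y" for y
    unfolding evidence_def likelihood_Un[OF assms(3,4,6)]
    by (rule spin_average_series[OF assms(1,2,5)])
       (auto intro: likelihood_cong[OF e1] likelihood_cong[OF e2] simp: likelihood_flip[OF e1] likelihood_flip[OF e2])
  have q: "correlation (V1 \<union> V2) (S1 \<union> S2) u v y = correlation V1 S1 u w y * correlation V2 S2 w v y" for y
  proof -
    \<comment> \<open>Since \<open>x w\<close> squares to 1, \<open>x u * x v\<close> splits as
      \<open>(x u * x w) * (x w * x v)\<close>. Each factor sees the spins of one part only and,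
      having two spins, is invariant under the global flip.\<close>
    let ?f = "\<lambda>x. of_int (x u * x w) * likelihood S1 y x" and ?g = "\<lambda>x. of_int (x w * x v) * likelihood S2 y x"
    have "correlation (V1 \<union> V2) (S1 \<union> S2) u v y = spin_average (V1 \<union> V2) (\<lambda>x. ?f x * ?g x)"
      unfolding correlation_def
    proof (rule spin_average_cong)
      fix x assume x: "x \<in> spin_configs (V1 \<union> V2)"
      show "of_int (x u * x v) * likelihood (S1 \<union> S2) y x = ?f x * ?g x"
        by (rule spin_configs_cases[OF x UnI1[OF w(1)]]) (auto simp: likelihood_Un[OF assms(3,4,6)])
    qed
    also have "\<dots> = spin_average V1 ?f * spin_average V2 ?g"
    proof (rule spin_average_series[OF assms(1,2,5)])
      show "?f x = ?f x'" if "\<And>i. i \<in> V1 \<Longrightarrow> x i = x' i" for x x'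
        using that likelihood_cong[OF e1, of x x' y] w \<open>u \<in> V1\<close> by simp
      show "?g x = ?g x'" if "\<And>i. i \<in> V2 \<Longrightarrow> x i = x' i" for x x'
        using that likelihood_cong[OF e2, of x x' y] w \<open>v \<in> V2\<close> by simp
    qed (use w assms(9,10) in \<open>auto simp: likelihood_flip[OF e1] likelihood_flip[OF e2]\<close>)
    finally show ?thesis unfolding correlation_def .
  qed
  have "information (V1 \<union> V2) (S1 \<union> S2) u v =
    (\<integral>y. (correlation V1 S1 u w y * posterior V1 S1 u w y) * (correlation V2 S2 w v y * posterior V2 S2 w v y)
      \<partial>Pi\<^sub>M (S1 \<union> S2) \<mu>)"
    unfolding information_eq_posterior posterior_def by (simp add: p q mult.commute mult.left_commute)
  also have "\<dots> = information V1 S1 u w * information V2 S2 w v"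
    unfolding information_eq_posterior using w assms
    by (intro integral_local_fun_mult local_fun_mult local_fun_correlation local_fun_posterior) auto
  finally show ?thesis .
qed

lemma information_parallel:
  assumes "finite V1" "finite V2" "finite S1" "finite S2" "V1 \<inter> V2 = {u, v}" "S1 \<inter> S2 = {}" "u \<noteq> v"
    and e1: "ends ` S1 \<subseteq> V1 \<times> V1" and e2: "ends ` S2 \<subseteq> V2 \<times> V2"
  shows "information (V1 \<union> V2) (S1 \<union> S2) u v \<le> information V1 S1 u v + information V2 S2 u v"
proof -
  have w: "u \<in> V1" "u \<in> V2" "v \<in> V1" "v \<in> V2" using assms(5) by auto
  let ?L = "\<lambda>S y x. likelihood S y x" and ?C = "\<lambda>S y x. of_int (x u * x v) * likelihood S y x"
  let ?p1 = "evidence V1 S1" and ?p2 = "evidence V2 S2"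
    and ?q1 = "correlation V1 S1 u v" and ?q2 = "correlation V2 S2 u v"
    and ?m1 = "posterior V1 S1 u v" and ?m2 = "posterior V2 S2 u v"
  let ?E = "Pi\<^sub>M (S1 \<union> S2) \<mu>"
  have sq: "of_int (x u * x v) * of_int (x u * x v) = (1::real)"
    if "x \<in> spin_configs V" "u \<in> V" "v \<in> V" for x V
    by (rule spin_configs_cases[OF that(1,2)]; rule spin_configs_cases[OF that(1,3)]) auto
  have f: "?C S y x = ?C S y x'" if "\<And>i. i \<in> V \<Longrightarrow> x i = x' i" "u \<in> V" "v \<in> V"
    "ends ` S \<subseteq> V \<times> V" for S y x x' V
    using that(1)[of u] that(1)[of v] that(2,3) likelihood_cong[OF that(4), of x x' y] that(1) by simp
  have p: "evidence (V1 \<union> V2) (S1 \<union> S2) y = ?p1 y * ?p2 y + ?q1 y * ?q2 y" for y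
    unfolding evidence_def correlation_def likelihood_Un[OF assms(3,4,6)]
    by (rule spin_average_parallel[OF assms(1,2,5,7)])
       (auto intro: likelihood_cong[OF e1] likelihood_cong[OF e2] simp: likelihood_flip[OF e1] likelihood_flip[OF e2])
  have q: "correlation (V1 \<union> V2) (S1 \<union> S2) u v y = ?p1 y * ?q2 y + ?q1 y * ?p2 y" for y
  proof -
    \<comment> \<open>The factor \<open>x u * x v\<close> is attached to the second part. The cross
      term of the gluing rule then contains its square, which is 1, and so gives back the plain
      likelihood of that part.\<close>
    have "correlation (V1 \<union> V2) (S1 \<union> S2) u v y = spin_average (V1 \<union> V2) (\<lambda>x. ?L S1 y x * ?C S2 y x)"
      unfolding correlation_def likelihood_Un[OF assms(3,4,6)] by (simp add: ac_simps)
    also have "\<dots> = spin_average V1 (?L S1 y) * spin_average V2 (?C S2 y)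
        + spin_average V1 (?C S1 y) * spin_average V2 (\<lambda>x. of_int (x u * x v) * ?C S2 y x)"
    proof (rule spin_average_parallel[OF assms(1,2,5,7)])
      show "?C S2 y x = ?C S2 y x'" if "\<And>i. i \<in> V2 \<Longrightarrow> x i = x' i" for x x'
        by (rule f[OF that w(2,4) e2])
    qed (use w in \<open>auto intro: likelihood_cong[OF e1] likelihood_cong[OF e2] simp: likelihood_flip[OF e1] likelihood_flip[OF e2]\<close>)
    also have "spin_average V2 (\<lambda>x. of_int (x u * x v) * ?C S2 y x) = spin_average V2 (?L S2 y)"
      by (rule spin_average_cong) (use sq w in \<open>simp flip: mult.assoc\<close>)
    finally show ?thesis by (simp add: evidence_def correlation_def)
  qed
  note lf1 = local_fun_evidence[of S1 V1] local_fun_correlation[of S1 V1 u v] local_fun_posterior[OF e1 w(1,3)]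
  note lf2 = local_fun_evidence[of S2 V2] local_fun_correlation[of S2 V2 u v] local_fun_posterior[OF e2 w(2,4)]
  have e12: "ends ` (S1 \<union> S2) \<subseteq> (V1 \<union> V2) \<times> (V1 \<union> V2)"
    using e1 e2 by auto
  have i: "integrable ?E (\<lambda>y. F y * G y)" if "local_fun S1 F" "local_fun S2 G" for F G
    by (rule integrable_local_fun[of "S1 \<union> S2"])
       (use that in \<open>auto intro!: local_fun_mult elim: local_fun_mono\<close>)
  \<comment> \<open>The five terms of \<open>parallel_composition_bound\<close>, grouped as products
    over the two edge sets. Squares are written as products so that the closure rules for
    \<open>local_fun\<close> apply.\<close>
  let ?t1 = "\<lambda>y. (?q1 y * ?m1 y) * ?p2 y" and ?t2 = "\<lambda>y. ?p1 y * (?q2 y * ?m2 y)"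
    and ?t3 = "\<lambda>y. ?q1 y * ?q2 y" and ?t4 = "\<lambda>y. (?q1 y * (?m1 y * ?m1 y)) * ?q2 y"
    and ?t5 = "\<lambda>y. ?q1 y * (?q2 y * (?m2 y * ?m2 y))"
  have it: "integrable ?E ?t1" "integrable ?E ?t2" "integrable ?E ?t3" "integrable ?E ?t4" "integrable ?E ?t5"
    by (intro i local_fun_mult lf1 lf2)+
  have "information (V1 \<union> V2) (S1 \<union> S2) u v \<le> (\<integral>y. ?t1 y + ?t2 y + 2 * ?t3 y - ?t4 y - ?t5 y \<partial>?E)"
    unfolding information_def
  proof (rule integral_mono)
    have "local_fun (S1 \<union> S2) (\<lambda>y. correlation (V1 \<union> V2) (S1 \<union> S2) u v y * posterior (V1 \<union> V2) (S1 \<union> S2) u v y)"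
      using w by (intro local_fun_mult local_fun_correlation local_fun_posterior e12) auto
    from integrable_local_fun[OF this subset_refl]
    show "integrable ?E (\<lambda>y. (correlation (V1 \<union> V2) (S1 \<union> S2) u v y)\<^sup>2 / evidence (V1 \<union> V2) (S1 \<union> S2) y)"
      by (simp add: posterior_def power2_eq_square)
    show "integrable ?E (\<lambda>y. ?t1 y + ?t2 y + 2 * ?t3 y - ?t4 y - ?t5 y)"
      using it by auto
    fix y
    show "(correlation (V1 \<union> V2) (S1 \<union> S2) u v y)\<^sup>2 / evidence (V1 \<union> V2) (S1 \<union> S2) y
        \<le> ?t1 y + ?t2 y + 2 * ?t3 y - ?t4 y - ?t5 y"
      unfolding p q power2_eq_square[of "?m1 y", symmetric] power2_eq_square[of "?m2 y", symmetric]
      by (intro parallel_composition_bound evidence_nonneg abs_posterior_le_1 correlation_eq_posterior e1 e2 w)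
  qed
  also have "\<dots> = (\<integral>y. ?t1 y \<partial>?E) + (\<integral>y. ?t2 y \<partial>?E) + 2 * (\<integral>y. ?t3 y \<partial>?E)
      - (\<integral>y. ?t4 y \<partial>?E) - (\<integral>y. ?t5 y \<partial>?E)"
    using it by simp
  \<comment> \<open>In the first two terms the other part enters only through its evidence, which
    integrates to 1.\<close>
  also have "(\<integral>y. ?t1 y \<partial>?E) = information V1 S1 u v"
    using assms by (subst integral_local_fun_mult) (auto intro!: local_fun_mult lf1 lf2
      simp: integral_evidence information_eq_posterior)
  also have "(\<integral>y. ?t2 y \<partial>?E) = information V2 S2 u v"
    using assms by (subst integral_local_fun_mult) (auto intro!: local_fun_mult lf1 lf2
      simp: integral_evidence information_eq_posterior)
  \<comment> \<open>Each of the last three terms has a bare correlation as the factor of one part: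
    \<open>?q1\<close> in \<open>?t3\<close> and \<open>?t5\<close>, \<open>?q2\<close> in
    \<open>?t4\<close>. Its mean is 0.\<close>
  also have "(\<integral>y. ?t3 y \<partial>?E) = 0"
    using assms w by (subst integral_local_fun_mult) (auto intro!: local_fun_mult lf1 lf2
      simp: integral_correlation)
  also have "(\<integral>y. ?t4 y \<partial>?E) = 0"
    using assms w by (subst integral_local_fun_mult) (auto intro!: local_fun_mult lf1 lf2
      simp: integral_correlation)
  also have "(\<integral>y. ?t5 y \<partial>?E) = 0"
    using assms w by (subst integral_local_fun_mult) (auto intro!: local_fun_mult lf1 lf2
      simp: integral_correlation)
  finally show ?thesis by simp
qed

end


section \<open>Series-parallel graphs and their paths\<close>

text \<open>The absence of loops is part of the invariant because it forces the edge sets of a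
  series composition to be disjoint.\<close>

lemma series_parallel_wf:
  assumes "series_parallel ends V E u v"
  shows "finite V \<and> finite E \<and> u \<in> V \<and> v \<in> V \<and> u \<noteq> v \<and>
    (\<forall>e\<in>E. ends e \<in> V \<times> V \<and> fst (ends e) \<noteq> snd (ends e))"
  using assms
proof induction
  case (series V1 E1 u w V2 E2 v)
  \<comment> \<open>If \<open>u\<close> and \<open>v\<close> coincided, they would lie in both
    vertex sets and hence equal \<open>w\<close>.\<close>
  then have "u \<noteq> v" by blast
  with series show ?case by auto
qed (auto simp: joins_def)

text \<open>A common edge would have its two distinct ends in \<open>V1 \<inter> V2\<close>, which
  is a single vertex. Disjointness is what lets likelihoods factor and glued paths be taken
  apart.\<close>

lemma series_edges_disjoint:
  assumes "series_parallel ends V1 E1 u w" "series_parallel ends V2 E2 w v" "V1 \<inter> V2 = {w}"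
  shows "E1 \<inter> E2 = {}"
proof (rule ccontr)
  assume "E1 \<inter> E2 \<noteq> {}"
  then obtain e where "e \<in> E1" "e \<in> E2" by auto
  then have "ends e \<in> V1 \<times> V1" "ends e \<in> V2 \<times> V2" "fst (ends e) \<noteq> snd (ends e)"
    using series_parallel_wf assms(1,2) by metis+
  then have "fst (ends e) \<in> V1 \<inter> V2" "snd (ends e) \<in> V1 \<inter> V2"
    by (auto simp: mem_Times_iff)
  then show False using \<open>fst (ends e) \<noteq> snd (ends e)\<close> assms(3) by auto
qed

section \<open>Paths in composed graphs\<close>

lemma finite_paths:
  assumes "finite V" "finite E" shows "finite (paths ends V E u v)"
proof (rule finite_subset)
  show "paths ends V E u v \<subseteq> {vs. set vs \<subseteq> V \<and> distinct vs} \<times> {es. set es \<subseteq> E \<and> length es \<le> card V}"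
  proof clarsimp
    fix vs es assume "(vs, es) \<in> paths ends V E u v"
    then have *: "set vs \<subseteq> V" "distinct vs" "set es \<subseteq> E" "length vs = Suc (length es)"
      by (auto simp: paths_def)
    then have "length vs \<le> card V" using assms(1) by (metis card_mono distinct_card)
    with * show "set vs \<subseteq> V \<and> distinct vs \<and> set es \<subseteq> E \<and> length es \<le> card V" by simp
  qed
  show "finite ({vs. set vs \<subseteq> V \<and> distinct vs} \<times> {es. set es \<subseteq> E \<and> length es \<le> card V})"
    using assms finite_subset_distinct[of V] finite_lists_length_le[of E "card V"]
    by (auto simp: conj_commute)
qed

lemma path_edges_subset: "P \<in> paths ends V E u v \<Longrightarrow> path_edges P \<subseteq> E"
  by (auto simp: paths_def path_edges_def)

lemma path_edges_nonempty: "P \<in> paths ends V E u v \<Longrightarrow> u \<noteq> v \<Longrightarrow> path_edges P \<noteq> {}"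
  by (auto simp: paths_def path_edges_def length_Suc_conv)

lemma paths_mono: "V \<subseteq> V' \<Longrightarrow> E \<subseteq> E' \<Longrightarrow> paths ends V E u v \<subseteq> paths ends V' E' u v"
  by (auto simp: paths_def)

lemma paths_single_edge:
  assumes "joins ends e u v" "u \<noteq> v"
  shows "([u, v], [e]) \<in> paths ends {u, v} {e} u v"
  using assms by (simp add: paths_def)

text \<open>The junction \<open>w\<close> ends the first vertex list and starts the second, so the
  second loses its head. No other vertex can repeat, since the parts share only
  \<open>w\<close>.\<close>

lemma paths_append:
  assumes P: "(vs1, es1) \<in> paths ends V1 E1 u w" and Q: "(vs2, es2) \<in> paths ends V2 E2 w v"
    and V: "V1 \<inter> V2 = {w}"
  shows "(vs1 @ tl vs2, es1 @ es2) \<in> paths ends (V1 \<union> V2) (E1 \<union> E2) u v"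
proof -
  have 1: "length vs1 = Suc (length es1)" "hd vs1 = u" "last vs1 = w" "distinct vs1"
    "set vs1 \<subseteq> V1" "set es1 \<subseteq> E1"
    and j1: "\<And>i. i < length es1 \<Longrightarrow> joins ends (es1 ! i) (vs1 ! i) (vs1 ! Suc i)"
    using P by (auto simp: paths_def)
  have 2: "length vs2 = Suc (length es2)" "hd vs2 = w" "last vs2 = v" "distinct vs2"
    "set vs2 \<subseteq> V2" "set es2 \<subseteq> E2"
    and j2: "\<And>i. i < length es2 \<Longrightarrow> joins ends (es2 ! i) (vs2 ! i) (vs2 ! Suc i)"
    using Q by (auto simp: paths_def)
  obtain ws where ws: "vs2 = w # ws" using 2(1,2) by (cases vs2) auto
  have ne: "vs1 \<noteq> []" using 1(1) by auto
  have "vs1 ! length es1 = w" using 1(1,3) ne by (simp add: last_conv_nth)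
  \<comment> \<open>Read from index \<open>length es1\<close> on, the glued list is all of
    \<open>vs2\<close>: its head \<open>w\<close> is supplied by the last vertex of
    \<open>vs1\<close>.\<close>
  then have nth: "(vs1 @ ws) ! (length es1 + k) = vs2 ! k" for k
    using 1(1) by (cases k) (auto simp: ws nth_append)
  have nth1: "(vs1 @ ws) ! k = vs1 ! k" if "k \<le> length es1" for k
    using that 1(1) by (simp add: nth_append)
  have "joins ends ((es1 @ es2) ! i) ((vs1 @ ws) ! i) ((vs1 @ ws) ! Suc i)"
    if "i < length es1 + length es2" for i
  proof (cases "i < length es1")
    case True
    then show ?thesis using j1[OF True] nth1[of i] nth1[of "Suc i"] by (simp add: nth_append)
  next
    case False
    then obtain k where k: "i = length es1 + k" by (metis le_add_diff_inverse not_less)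
    then show ?thesis using j2[of k] that nth[of k] nth[of "Suc k"] by simp
  qed
  moreover have "distinct (vs1 @ ws)"
  proof -
    have "set vs1 \<inter> set ws \<subseteq> V1 \<inter> V2" using 1(5) 2(5) by (auto simp: ws)
    moreover have "w \<notin> set ws" using 2(4) by (simp add: ws)
    ultimately show ?thesis using 1(4) 2(4) V by (auto simp: ws)
  qed
  moreover have "last (vs1 @ ws) = v" using 1(3) 2(3) by (auto simp: ws)
  ultimately show ?thesis using 1 2 ne by (auto simp: paths_def ws)
qed

text \<open>Gluing paths is injective because the edge sets are disjoint.\<close>

lemma sum_paths_series_le:
  fixes ends :: "'e \<Rightarrow> 'v \<times> 'v" and c :: "'e \<Rightarrow> real"
  assumes "finite V1" "finite V2" "finite E1" "finite E2"
    and V: "V1 \<inter> V2 = {w}" and E: "E1 \<inter> E2 = {}" and c: "\<And>e. 0 \<le> c e"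
  shows "(\<Sum>P\<in>paths ends V1 E1 u w. \<Prod>e\<in>path_edges P. c e) * (\<Sum>P\<in>paths ends V2 E2 w v. \<Prod>e\<in>path_edges P. c e)
    \<le> (\<Sum>P\<in>paths ends (V1 \<union> V2) (E1 \<union> E2) u v. \<Prod>e\<in>path_edges P. c e)"
proof -
  let ?A = "paths ends V1 E1 u w" and ?B = "paths ends V2 E2 w v"
  define glue where "glue = (\<lambda>((vs1, es1), (vs2, es2)). (vs1 @ tl vs2 :: 'v list, es1 @ es2 :: 'e list))"
  have inj: "inj_on glue (?A \<times> ?B)"
  proof (rule inj_on_inverseI)
    fix R assume "R \<in> ?A \<times> ?B"
    then obtain vs1 es1 vs2 es2 where R: "R = ((vs1, es1), (vs2, es2))"
      and 1: "(vs1, es1) \<in> ?A" and 2: "(vs2, es2) \<in> ?B" by auto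
    have "set es1 \<subseteq> E1" "set es2 \<subseteq> E2" using 1 2 by (auto simp: paths_def)
    then have "filter (\<lambda>e. e \<in> E1) es1 = es1" "filter (\<lambda>e. e \<in> E1) es2 = []"
      "filter (\<lambda>e. e \<notin> E1) es1 = []" "filter (\<lambda>e. e \<notin> E1) es2 = es2"
      using E by (auto simp: filter_id_conv filter_empty_conv)
    moreover have "length vs1 = Suc (length es1)" "vs2 = w # tl vs2"
      using 1 2 by (auto simp: paths_def) (metis length_Suc_conv list.sel(1,3))
    \<comment> \<open>A left inverse of gluing: the edges in \<open>E1\<close> recover the first
      edge list, its length says where to cut the vertex list, and \<open>w\<close> is put back in
      front of the second piece.\<close>
    ultimately show "(\<lambda>(vs, es). let es1 = filter (\<lambda>e. e \<in> E1) es in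
        ((take (Suc (length es1)) vs, es1),
         (w # drop (Suc (length es1)) vs, filter (\<lambda>e. e \<notin> E1) es))) (glue R) = R"
      by (simp add: R glue_def)
  qed
  have prod: "(\<Prod>e\<in>path_edges (glue (P, Q)). c e) = (\<Prod>e\<in>path_edges P. c e) * (\<Prod>e\<in>path_edges Q. c e)"
    if "P \<in> ?A" "Q \<in> ?B" for P Q
  proof -
    have "path_edges (glue (P, Q)) = path_edges P \<union> path_edges Q"
      by (cases P; cases Q) (simp add: glue_def path_edges_def)
    moreover have "path_edges P \<inter> path_edges Q = {}"
      using path_edges_subset[OF that(1)] path_edges_subset[OF that(2)] E by auto
    ultimately show ?thesis by (simp add: prod.union_disjoint path_edges_def)
  qed
  have "(\<Sum>P\<in>?A. \<Prod>e\<in>path_edges P. c e) * (\<Sum>P\<in>?B. \<Prod>e\<in>path_edges P. c e)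
      = (\<Sum>R\<in>?A \<times> ?B. \<Prod>e\<in>path_edges (glue R). c e)"
    unfolding sum_product sum.cartesian_product by (rule sum.cong) (auto simp: prod)
  also have "\<dots> = (\<Sum>P\<in>glue ` (?A \<times> ?B). \<Prod>e\<in>path_edges P. c e)"
    by (simp add: sum.reindex[OF inj])
  \<comment> \<open>Glued paths are among the paths of the union, and all weights are
    nonnegative.\<close>
  also have "\<dots> \<le> (\<Sum>P\<in>paths ends (V1 \<union> V2) (E1 \<union> E2) u v. \<Prod>e\<in>path_edges P. c e)"
    using assms paths_append[OF _ _ V]
    by (intro sum_mono2 finite_paths prod_nonneg) (auto simp: glue_def)
  finally show ?thesis .
qed

text \<open>Paths of the two parts never coincide: their edge sets are nonempty, as the terminals
  differ, and lie in disjoint sets.\<close>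

lemma sum_paths_parallel_le:
  fixes c :: "'e \<Rightarrow> real"
  assumes "finite V1" "finite V2" "finite E1" "finite E2"
    and "u \<noteq> v" and E: "E1 \<inter> E2 = {}" and c: "\<And>e. 0 \<le> c e"
  shows "(\<Sum>P\<in>paths ends V1 E1 u v. \<Prod>e\<in>path_edges P. c e) + (\<Sum>P\<in>paths ends V2 E2 u v. \<Prod>e\<in>path_edges P. c e)
    \<le> (\<Sum>P\<in>paths ends (V1 \<union> V2) (E1 \<union> E2) u v. \<Prod>e\<in>path_edges P. c e)"
proof -
  let ?A = "paths ends V1 E1 u v" and ?B = "paths ends V2 E2 u v"
  have "P \<notin> ?B" if "P \<in> ?A" for P
    using path_edges_subset[OF that] path_edges_nonempty[OF that \<open>u \<noteq> v\<close>] path_edges_subset[of P ends V2 E2 u v] E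
    by auto
  then have "?A \<inter> ?B = {}" by auto
  then have "(\<Sum>P\<in>?A. \<Prod>e\<in>path_edges P. c e) + (\<Sum>P\<in>?B. \<Prod>e\<in>path_edges P. c e)
      = (\<Sum>P\<in>?A \<union> ?B. \<Prod>e\<in>path_edges P. c e)"
    using assms by (simp add: sum.union_disjoint finite_paths)
  also have "\<dots> \<le> (\<Sum>P\<in>paths ends (V1 \<union> V2) (E1 \<union> E2) u v. \<Prod>e\<in>path_edges P. c e)"
    using assms paths_mono[of V1 "V1 \<union> V2" E1 "E1 \<union> E2" ends u v] paths_mono[of V2 "V1 \<union> V2" E2 "E1 \<union> E2" ends u v]
    by (intro sum_mono2 finite_paths prod_nonneg) auto
  finally show ?thesis .
qed

section \<open>Information along a path, and the bound by induction over compositions\<close>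

context edge_likelihoods
begin

lemma likelihood_insert:
  assumes "finite S" "e \<notin> S" "joins ends e a b"
  shows "likelihood (insert e S) y x = likelihood S y x + \<theta> e (y e) * (of_int (x a * x b) * likelihood S y x)"
  using assms by (auto simp: likelihood_def edge_spin_def joins_def algebra_simps)

text \<open>
  Flipping the spin of the first vertex \<open>a\<close> alone leaves the likelihood of the remaining edges
  unchanged, so all terms in which \<open>x\<^sub>a\<close> survives average to zero.
\<close>

lemma likelihood_walk:
  assumes "finite V" "length vs = Suc (length es)" "distinct vs" "set vs \<subseteq> V"
    and "\<And>i. i < length es \<Longrightarrow> joins ends (es ! i) (vs ! i) (vs ! Suc i)"
  shows "ends ` set es \<subseteq> set vs \<times> set vs \<and> evidence V (set es) y = 1 \<and>
    correlation V (set es) (hd vs) (last vs) y = (\<Prod>e\<in>set es. \<theta> e (y e))"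
  using assms(2-)
proof (induction es arbitrary: vs)
  case Nil
  then obtain a where [simp]: "vs = [a]" "a \<in> V" by (auto simp: length_Suc_conv)
  have "spin_average V (\<lambda>x. of_int (x a * x a)) = spin_average V (\<lambda>_. 1)"
    by (rule spin_average_cong) (auto elim!: spin_configs_cases[where w = a])
  moreover have "likelihood {} y = (\<lambda>_. 1)" by (simp add: likelihood_def fun_eq_iff)
  ultimately show ?case using assms(1) by (simp add: evidence_def correlation_def)
next
  case (Cons e es)
  obtain a b ws where vs: "vs = a # b # ws"
    using Cons.prems(1) by (auto simp: length_Suc_conv)
  let ?S = "set es" and ?W = "set (b # ws)"
  define l where "l = last (b # ws)"
  have l: "l \<in> ?W" "last vs = l" unfolding l_def vs by (rule last_in_set) auto
  have ab: "joins ends e a b" using Cons.prems(4)[of 0] by (simp add: vs)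
  have a: "a \<in> V" "a \<notin> ?W" "b \<noteq> a" "l \<noteq> a" "b \<in> V" using Cons.prems(2,3) l by (auto simp: vs)
  have "ends ` ?S \<subseteq> ?W \<times> ?W \<and> evidence V ?S y = 1 \<and>
      correlation V ?S (hd (b # ws)) (last (b # ws)) y = (\<Prod>e\<in>?S. \<theta> e (y e))"
    by (rule Cons.IH) (use Cons.prems Cons.prems(4)[of "Suc i" for i] in \<open>auto simp: vs\<close>)
  then have IH: "ends ` ?S \<subseteq> ?W \<times> ?W" "evidence V ?S y = 1"
    "correlation V ?S b l y = (\<Prod>e\<in>?S. \<theta> e (y e))" by (simp_all add: l_def)
  \<comment> \<open>Here the first conjunct of the induction hypothesis is used: the remaining edges
    avoid \<open>a\<close>. So \<open>e\<close> does not recur, and their likelihood does not depend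
    on the spin of \<open>a\<close>.\<close>
  have e: "e \<notin> ?S" using IH(1) ab a(2) by (auto simp: joins_def)
  have upd: "likelihood ?S y (x(a := s)) = likelihood ?S y x" for x s
    by (rule likelihood_cong[OF IH(1)]) (use a(2) in auto)
  have odd: "spin_average V (\<lambda>x. of_int (x a * x k) * likelihood ?S y x) = 0" if "k \<noteq> a" for k
    using that a(1) by (intro spin_average_vertex_odd[of a]) (auto simp: upd)
  have "evidence V (set (e # es)) y
      = evidence V ?S y + \<theta> e (y e) * spin_average V (\<lambda>x. of_int (x a * x b) * likelihood ?S y x)"
  proof -
    have "likelihood (set (e # es)) y
        = (\<lambda>x. likelihood ?S y x + \<theta> e (y e) * (of_int (x a * x b) * likelihood ?S y x))"
      using likelihood_insert[OF _ e ab] by (intro ext) simp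
    then show ?thesis unfolding evidence_def by (simp only: spin_average_add spin_average_cmult)
  qed
  then have ev: "evidence V (set (e # es)) y = 1" using IH(2) odd[OF a(3)] by simp
  \<comment> \<open>Expanding the factor of \<open>e\<close> and using that \<open>x a\<close>
    squares to 1 moves the correlation from \<open>a\<close> to \<open>b\<close>, at the cost of
    \<open>\<theta> e (y e)\<close>; the other term is odd in \<open>x a\<close>.\<close>
  have "correlation V (set (e # es)) a l y = spin_average V (\<lambda>x. of_int (x a * x l) * likelihood ?S y x
      + \<theta> e (y e) * (of_int (x b * x l) * likelihood ?S y x))"
    unfolding correlation_def
  proof (rule spin_average_cong)
    fix x assume x: "x \<in> spin_configs V"
    show "of_int (x a * x l) * likelihood (set (e # es)) y x = of_int (x a * x l) * likelihood ?S y x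
      + \<theta> e (y e) * (of_int (x b * x l) * likelihood ?S y x)"
      by (rule spin_configs_cases[OF x a(1)]) (auto simp: likelihood_insert[OF _ e ab] algebra_simps)
  qed
  also have "\<dots> = \<theta> e (y e) * correlation V ?S b l y"
    using odd[OF a(4)] by (simp add: spin_average_add spin_average_cmult correlation_def)
  finally have "correlation V (set (e # es)) a l y = (\<Prod>e\<in>set (e # es). \<theta> e (y e))"
    using IH(3) e by simp
  then show ?case using ev l(2) IH(1) ab by (auto simp: vs joins_def)
qed

text \<open>On a path the evidence is 1, so the integrand is a product of functions of single
  observations and the product measure separates it.\<close>

lemma information_path:
  assumes "finite V" "P \<in> paths ends V E u v"
  shows "information V (path_edges P) u v = (\<Prod>e\<in>path_edges P. \<integral>y. (\<theta> e y)\<^sup>2 \<partial>\<mu> e)"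
proof -
  obtain vs es where P: "P = (vs, es)" by (cases P)
  have *: "evidence V (set es) y = 1 \<and> correlation V (set es) u v y = (\<Prod>e\<in>set es. \<theta> e (y e))" for y
    using likelihood_walk[OF assms(1), of vs es y] assms(2) by (auto simp: P paths_def)
  have "information V (path_edges P) u v = (\<integral>y. (\<Prod>e\<in>set es. (\<theta> e (y e))\<^sup>2) \<partial>Pi\<^sub>M (set es) \<mu>)"
    unfolding information_def path_edges_def P by (simp add: * prod_power_distrib)
  also have "\<dots> = (\<Prod>e\<in>set es. \<integral>y. (\<theta> e y)\<^sup>2 \<partial>\<mu> e)"
  proof (rule product_integral_prod)
    show "integrable (\<mu> e) (\<lambda>y. (\<theta> e y)\<^sup>2)" for e
      by (rule M.integrable_const_bound[where B = 1]) (auto simp: \<theta>_le_1 abs_square_le_1)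
  qed simp
  finally show ?thesis by (simp add: P path_edges_def)
qed

text \<open>The bound is stated with edge weights, the integrals of the squared \<theta>, rather
  than with path informations. The weight of a path then does not depend on the surrounding vertex
  set, which changes during the induction.\<close>

lemma information_le_sum_paths:
  assumes "series_parallel ends V E u v"
  shows "information V E u v \<le> (\<Sum>P\<in>paths ends V E u v. \<Prod>e\<in>path_edges P. \<integral>y. (\<theta> e y)\<^sup>2 \<partial>\<mu> e)"
  using assms
proof induction
  case (single_edge e u v)
  let ?P = "([u, v], [e])"
  have P: "?P \<in> paths ends {u, v} {e} u v" using single_edge by (rule paths_single_edge)
  have "information {u, v} {e} u v = (\<Prod>e\<in>path_edges ?P. \<integral>y. (\<theta> e y)\<^sup>2 \<partial>\<mu> e)"
    using information_path[OF _ P] by (simp add: path_edges_def)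
  also have "\<dots> \<le> (\<Sum>P\<in>paths ends {u, v} {e} u v. \<Prod>e\<in>path_edges P. \<integral>y. (\<theta> e y)\<^sup>2 \<partial>\<mu> e)"
    using P by (intro member_le_sum finite_paths prod_nonneg integral_nonneg_AE) auto
  finally show ?case .
next
  case (series V1 E1 u w V2 E2 v)
  note wf = series_parallel_wf[OF series.hyps(1)] series_parallel_wf[OF series.hyps(2)]
  note dj = series_edges_disjoint[OF series.hyps]
  have nonneg: "0 \<le> information V2 E2 w v"
    unfolding information_def using wf
    by (intro integral_nonneg_AE AE_I2 divide_nonneg_nonneg evidence_nonneg) auto
  have "information (V1 \<union> V2) (E1 \<union> E2) u v = information V1 E1 u w * information V2 E2 w v"
    by (rule information_series) (use wf dj series.hyps in auto)
  also have "\<dots> \<le> (\<Sum>P\<in>paths ends V1 E1 u w. \<Prod>e\<in>path_edges P. \<integral>y. (\<theta> e y)\<^sup>2 \<partial>\<mu> e) *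
      (\<Sum>P\<in>paths ends V2 E2 w v. \<Prod>e\<in>path_edges P. \<integral>y. (\<theta> e y)\<^sup>2 \<partial>\<mu> e)"
    using nonneg by (intro mult_mono series.IH sum_nonneg prod_nonneg integral_nonneg_AE) auto
  also have "\<dots> \<le> (\<Sum>P\<in>paths ends (V1 \<union> V2) (E1 \<union> E2) u v. \<Prod>e\<in>path_edges P. \<integral>y. (\<theta> e y)\<^sup>2 \<partial>\<mu> e)"
    using wf dj series.hyps by (intro sum_paths_series_le[where w = w] integral_nonneg_AE) auto
  finally show ?case .
next
  case (parallel V1 E1 u v V2 E2)
  note wf = series_parallel_wf[OF parallel.hyps(1)] series_parallel_wf[OF parallel.hyps(2)]
  have "information (V1 \<union> V2) (E1 \<union> E2) u v \<le> information V1 E1 u v + information V2 E2 u v"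
    by (rule information_parallel) (use wf parallel.hyps in auto)
  also have "\<dots> \<le> (\<Sum>P\<in>paths ends V1 E1 u v. \<Prod>e\<in>path_edges P. \<integral>y. (\<theta> e y)\<^sup>2 \<partial>\<mu> e) +
      (\<Sum>P\<in>paths ends V2 E2 u v. \<Prod>e\<in>path_edges P. \<integral>y. (\<theta> e y)\<^sup>2 \<partial>\<mu> e)"
    by (intro add_mono parallel.IH)
  also have "\<dots> \<le> (\<Sum>P\<in>paths ends (V1 \<union> V2) (E1 \<union> E2) u v. \<Prod>e\<in>path_edges P. \<integral>y. (\<theta> e y)\<^sup>2 \<partial>\<mu> e)"
    using wf parallel.hyps by (intro sum_paths_parallel_le integral_nonneg_AE) auto
  finally show ?case .
qed

end


section \<open>Chi-squared information of spins\<close>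

abbreviation spin_pairs :: "(int \<times> int) set" where
  "spin_pairs \<equiv> {-1, 1} \<times> {-1, 1}"

lemma spins_pair: "spins \<Otimes>\<^sub>M spins = count_space spin_pairs"
  by (rule pair_measure_countable) auto

lemma sets_spins_pair: "sets (spins \<Otimes>\<^sub>M spins) = Pow spin_pairs"
  by (subst spins_pair) (rule sets_count_space)

text \<open>Both marginals are uniform, so the product of the marginals gives each pair mass 1/4 and
  the joint density is \<open>1 + s t m\<close>. Its squared deviation from 1 is the constant
  \<open>m\<^sup>2\<close>.\<close>

lemma chi2_info_spins:
  assumes sets: "sets \<nu> = sets (spins \<Otimes>\<^sub>M spins)" and m: "\<bar>m\<bar> \<le> 1"
    and \<nu>: "\<And>s t. s \<in> {-1, 1} \<Longrightarrow> t \<in> {-1, 1} \<Longrightarrow> emeasure \<nu> {(s, t)} = ennreal ((1 + of_int (s * t) * m) / 4)"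
  shows "chi2_info spins spins \<nu> = ennreal (m\<^sup>2)"
proof -
  have sets_\<nu>: "sets \<nu> = Pow spin_pairs" using sets by (simp only: sets_spins_pair)
  then have space_\<nu>: "space \<nu> = spin_pairs" by (metis sets_eq_imp_space_eq sets_count_space space_count_space)
  have fst [measurable]: "fst \<in> \<nu> \<rightarrow>\<^sub>M spins" and snd [measurable]: "snd \<in> \<nu> \<rightarrow>\<^sub>M spins"
    unfolding measurable_cong_sets[OF sets refl] by simp_all
  have pair: "emeasure \<nu> {(s, t), (s', t')} = ennreal ((1 + of_int (s * t) * m) / 4 + (1 + of_int (s' * t') * m) / 4)"
    if "s \<in> {-1, 1}" "t \<in> {-1, 1}" "s' \<in> {-1, 1}" "t' \<in> {-1, 1}" "(s, t) \<noteq> (s', t')" for s t s' t'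
  proof -
    have "emeasure \<nu> {(s, t), (s', t')} = emeasure \<nu> {(s, t)} + emeasure \<nu> {(s', t')}"
      using that sets_\<nu> by (subst plus_emeasure) (auto simp: insert_commute)
    moreover have "0 \<le> 1 + of_int (s * t) * m" "0 \<le> 1 + of_int (s' * t') * m" using that m by auto
    ultimately show ?thesis by (simp only: \<nu>[OF that(1,2)] \<nu>[OF that(3,4)]) (simp flip: ennreal_plus)
  qed
  have f: "emeasure (distr \<nu> spins fst) {s} = ennreal (1/2)" if "s \<in> {-1, 1}" for s
  proof -
    have "emeasure (distr \<nu> spins fst) {s} = emeasure \<nu> {(s, -1), (s, 1)}"
      using that by (subst emeasure_distr) (auto simp: space_\<nu> intro!: arg_cong[where f = "emeasure \<nu>"])
    also have "\<dots> = ennreal (1/2)" using that by (subst pair) (auto simp: field_simps)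
    finally show ?thesis .
  qed
  have g: "emeasure (distr \<nu> spins snd) {t} = ennreal (1/2)" if "t \<in> {-1, 1}" for t
  proof -
    have "emeasure (distr \<nu> spins snd) {t} = emeasure \<nu> {(-1, t), (1, t)}"
      using that by (subst emeasure_distr) (auto simp: space_\<nu> intro!: arg_cong[where f = "emeasure \<nu>"])
    also have "\<dots> = ennreal (1/2)" using that by (subst pair) (auto simp: field_simps)
    finally show ?thesis .
  qed
  define \<mu> where "\<mu> = distr \<nu> spins fst \<Otimes>\<^sub>M distr \<nu> spins snd"
  have "sets \<mu> = sets (spins \<Otimes>\<^sub>M spins)" unfolding \<mu>_def by (rule sets_pair_measure_cong) simp_all
  then have sets_\<mu>: "sets \<mu> = Pow spin_pairs" by (simp only: sets_spins_pair)
  then have space_\<mu>: "space \<mu> = spin_pairs" by (metis sets_eq_imp_space_eq sets_count_space space_count_space)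
  interpret S: finite_measure "distr \<nu> spins snd"
  proof (rule finite_measureI)
    have "emeasure (distr \<nu> spins snd) (space (distr \<nu> spins snd)) = (\<Sum>t\<in>{-1, 1}. emeasure (distr \<nu> spins snd) {t})"
      by (subst emeasure_eq_sum_singleton) auto
    also have "\<dots> = (\<Sum>t\<in>{-1, 1 :: int}. ennreal (1/2))" by (intro sum.cong refl g)
    also have "\<dots> = ennreal (\<Sum>t\<in>{-1, 1 :: int}. 1/2)" by (rule sum_ennreal) simp
    finally show "emeasure (distr \<nu> spins snd) (space (distr \<nu> spins snd)) \<noteq> \<infinity>" by simp
  qed
  have \<mu>: "emeasure \<mu> {z} = ennreal (1/4)" if "z \<in> spin_pairs" for z
  proof -
    from that obtain s t where z: "s \<in> {-1, 1}" "t \<in> {-1, 1}" "z = (s, t)" by (rule SigmaE)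
    have "emeasure \<mu> ({s} \<times> {t}) = ennreal (1/2) * ennreal (1/2)"
      unfolding \<mu>_def using z by (subst S.emeasure_pair_measure_Times) (auto simp: f g)
    also have "\<dots> = ennreal (1/4)" by (subst ennreal_mult[symmetric]) auto
    finally show ?thesis by (simp add: z)
  qed
  have total: "emeasure \<mu> (space \<mu>) = 1"
  proof -
    have "emeasure \<mu> (space \<mu>) = (\<Sum>z\<in>spin_pairs. emeasure \<mu> {z})"
      unfolding space_\<mu> by (rule emeasure_eq_sum_singleton) (auto simp: sets_\<mu>)
    also have "\<dots> = (\<Sum>z\<in>spin_pairs. ennreal (1/4))" by (intro sum.cong refl \<mu>)
    also have "\<dots> = ennreal (\<Sum>z\<in>spin_pairs. 1/4)" by (rule sum_ennreal) simp
    also have "\<dots> = 1" by (simp add: card_cartesian_product)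
    finally show ?thesis .
  qed
  then interpret P: prob_space \<mu> by (rule prob_spaceI)
  define d where "d z = ennreal (1 + of_int (fst z * snd z) * m)" for z :: "int \<times> int"
  have d_borel: "d \<in> borel_measurable \<mu>"
    by (auto simp: measurable_def sets_\<mu> space_\<mu>)
  have \<nu>_eq: "density \<mu> d = \<nu>"
  proof (rule measure_eqI_finite[of _ spin_pairs])
    fix z assume z: "z \<in> spin_pairs"
    then have nonneg: "0 \<le> 1 + of_int (fst z * snd z) * m" using m by auto
    have "emeasure (density \<mu> d) {z} = d z * emeasure \<mu> {z}"
      using z by (simp add: emeasure_density d_borel sets_\<mu> nn_integral_indicator_singleton)
    also have "\<dots> = emeasure \<nu> {z}"
      using z nonneg \<nu>[of "fst z" "snd z"] by (auto simp: \<mu> d_def simp flip: ennreal_mult)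
    finally show "emeasure (density \<mu> d) {z} = emeasure \<nu> {z}" .
  qed (auto simp: sets_\<mu> sets_\<nu>)
  have ac: "absolutely_continuous \<mu> \<nu>"
    using absolutely_continuousI_density[OF d_borel] by (simp add: \<nu>_eq)
  have "AE z in \<mu>. d z = RN_deriv \<mu> \<nu> z"
    by (rule P.RN_deriv_unique[OF d_borel \<nu>_eq])
  then have "AE z in \<mu>. ennreal ((enn2real (RN_deriv \<mu> \<nu> z) - 1)\<^sup>2) = ennreal (m\<^sup>2)"
  proof (rule AE_mp[OF _ AE_I2], intro impI)
    fix z assume z: "z \<in> space \<mu>" and eq: "d z = RN_deriv \<mu> \<nu> z"
    have "0 \<le> 1 + of_int (fst z * snd z) * m" using z m by (auto simp: space_\<mu>)
    then show "ennreal ((enn2real (RN_deriv \<mu> \<nu> z) - 1)\<^sup>2) = ennreal (m\<^sup>2)"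
      using z by (auto simp: d_def space_\<mu> simp flip: eq)
  qed
  then have "(\<integral>\<^sup>+z. ennreal ((enn2real (RN_deriv \<mu> \<nu> z) - 1)\<^sup>2) \<partial>\<mu>) = (\<integral>\<^sup>+z. ennreal (m\<^sup>2) \<partial>\<mu>)"
    by (rule nn_integral_cong_AE)
  then show ?thesis
    using ac by (simp add: chi2_info_def Let_def total flip: \<mu>_def)
qed

section \<open>Conditional information of two spins\<close>

lemma is_cond_lawD:
  assumes "is_cond_law M S A T B U C K" "D \<in> sets U" "F \<in> sets (S \<Otimes>\<^sub>M T)"
  shows "emeasure M {\<omega> \<in> space M. C \<omega> \<in> D \<and> (A \<omega>, B \<omega>) \<in> F} = (\<integral>\<^sup>+c\<in>D. emeasure (K c) F \<partial>distr M U C)"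
  using assms by (auto simp: is_cond_law_def)

text \<open>The explicit kernel \<open>K\<close> shows that a conditional law exists, so the one
  picked by \<open>SOME\<close> is a conditional law too. The two have the same atoms for almost
  every value of \<open>C\<close>, and \<open>chi2_info_spins\<close> evaluates the information from
  the atoms.\<close>

lemma cond_chi2_info_spins:
  assumes "prob_space M"
    and A [measurable]: "A \<in> M \<rightarrow>\<^sub>M spins" and B [measurable]: "B \<in> M \<rightarrow>\<^sub>M spins"
    and C [measurable]: "C \<in> M \<rightarrow>\<^sub>M U"
    and m [measurable]: "m \<in> borel_measurable U" and m_le: "\<And>c. \<bar>m c\<bar> \<le> 1"
    and law: "\<And>s t D. s \<in> {-1, 1} \<Longrightarrow> t \<in> {-1, 1} \<Longrightarrow> D \<in> sets U \<Longrightarrow>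
      emeasure M {\<omega> \<in> space M. C \<omega> \<in> D \<and> A \<omega> = s \<and> B \<omega> = t} =
      (\<integral>\<^sup>+c\<in>D. ennreal ((1 + of_int (s * t) * m c) / 4) \<partial>distr M U C)"
  shows "cond_chi2_info M spins A spins B U C = (\<integral>\<^sup>+c. ennreal ((m c)\<^sup>2) \<partial>distr M U C)"
proof -
  interpret prob_space M by fact
  let ?L = "distr M U C"
  interpret L: prob_space ?L by (rule prob_space_distr) fact
  define k where "k c z = ennreal ((1 + of_int (fst z * snd z) * m c) / 4)" for c and z :: "int \<times> int"
  have k_borel [measurable]: "(\<lambda>c. k c z) \<in> borel_measurable U" for z unfolding k_def by measurable
  define K where "K c = density (count_space spin_pairs) (k c)" for c
  have K_eq: "emeasure (K c) F = (\<Sum>z\<in>F. k c z)" if "F \<subseteq> spin_pairs" for c F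
  proof -
    have "emeasure (K c) F = (\<Sum>z\<in>spin_pairs. k c z * indicator F z)"
      unfolding K_def using that by (subst emeasure_density) (auto simp: nn_integral_count_space_finite)
    also have "\<dots> = (\<Sum>z\<in>F. k c z)"
      using that by (intro sum.mono_neutral_cong_right) (auto simp: finite_subset)
    finally show ?thesis .
  qed
  have K_prob: "prob_space (K c)" for c
  proof (rule prob_spaceI)
    have "emeasure (K c) (space (K c)) = (\<Sum>z\<in>spin_pairs. k c z)"
      using K_eq[of spin_pairs c] by (simp add: K_def)
    also have "\<dots> = ennreal (\<Sum>z\<in>spin_pairs. (1 + of_int (fst z * snd z) * m c) / 4)"
      unfolding k_def using m_le[of c] by (intro sum_ennreal) auto
    also have "(\<Sum>z\<in>spin_pairs. (1 + of_int (fst z * snd z) * m c) / 4)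
        = (\<Sum>s\<in>{-1, 1}. \<Sum>t\<in>{-1, 1}. (1 + of_int (s * t) * m c) / 4)"
      by (simp add: sum.cartesian_product split_def)
    also have "\<dots> = 1" by (simp add: field_simps)
    finally show "emeasure (K c) (space (K c)) = 1" by simp
  qed
  have K: "is_cond_law M spins A spins B U C K"
    unfolding is_cond_law_def
  proof (intro conjI ballI)
    show "K \<in> U \<rightarrow>\<^sub>M prob_algebra (spins \<Otimes>\<^sub>M spins)"
    proof (rule measurable_prob_algebraI)
      show "K \<in> U \<rightarrow>\<^sub>M subprob_algebra (spins \<Otimes>\<^sub>M spins)"
      proof (rule measurable_subprob_algebra)
        show "subprob_space (K c)" for c by (rule prob_space_imp_subprob_space[OF K_prob])
        show "sets (K c) = sets (spins \<Otimes>\<^sub>M spins)" for c unfolding K_def sets_density sets_count_space sets_spins_pair ..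
        show "(\<lambda>c. emeasure (K c) F) \<in> borel_measurable U" if "F \<in> sets (spins \<Otimes>\<^sub>M spins)" for F
          using that unfolding sets_spins_pair by (simp add: K_eq)
      qed
    qed (rule K_prob)
    fix D F assume D [measurable]: "D \<in> sets U" and "F \<in> sets (spins \<Otimes>\<^sub>M spins)"
    then have F: "F \<subseteq> spin_pairs" by (simp only: sets_spins_pair Pow_iff)
    then have "finite F" by (auto simp: finite_subset)
    have "{\<omega> \<in> space M. C \<omega> \<in> D \<and> (A \<omega>, B \<omega>) \<in> F}
        = (\<Union>z\<in>F. {\<omega> \<in> space M. C \<omega> \<in> D \<and> A \<omega> = fst z \<and> B \<omega> = snd z})"
      by force
    also have "emeasure M \<dots> = (\<Sum>z\<in>F. emeasure M {\<omega> \<in> space M. C \<omega> \<in> D \<and> A \<omega> = fst z \<and> B \<omega> = snd z})"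
    proof (rule sum_emeasure[symmetric])
      have "{\<omega> \<in> space M. C \<omega> \<in> D \<and> A \<omega> = fst z \<and> B \<omega> = snd z} \<in> sets M" if "z \<in> F" for z
      proof -
        have "{\<omega> \<in> space M. C \<omega> \<in> D \<and> A \<omega> = fst z \<and> B \<omega> = snd z} =
          (C -` D \<inter> space M) \<inter> (A -` {fst z} \<inter> space M) \<inter> (B -` {snd z} \<inter> space M)" by auto
        also have "\<dots> \<in> sets M"
          using that F by (intro sets.Int measurable_sets[OF C] measurable_sets[OF A] measurable_sets[OF B] D) auto
        finally show ?thesis .
      qed
      then show "(\<lambda>z. {\<omega> \<in> space M. C \<omega> \<in> D \<and> A \<omega> = fst z \<and> B \<omega> = snd z}) ` F \<subseteq> sets M" by auto
      show "disjoint_family_on (\<lambda>z. {\<omega> \<in> space M. C \<omega> \<in> D \<and> A \<omega> = fst z \<and> B \<omega> = snd z}) F"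
        by (auto simp: disjoint_family_on_def)
    qed fact
    also have "\<dots> = (\<Sum>z\<in>F. \<integral>\<^sup>+c\<in>D. k c z \<partial>?L)"
      using F by (intro sum.cong refl) (auto simp: law D k_def)
    also have "\<dots> = (\<integral>\<^sup>+c. (\<Sum>z\<in>F. k c z * indicator D c) \<partial>?L)"
      by (rule nn_integral_sum[symmetric]) measurable
    also have "\<dots> = (\<integral>\<^sup>+c\<in>D. emeasure (K c) F \<partial>?L)"
      by (simp add: K_eq[OF F] sum_distrib_right)
    finally show "emeasure M {\<omega> \<in> space M. C \<omega> \<in> D \<and> (A \<omega>, B \<omega>) \<in> F}
        = (\<integral>\<^sup>+c\<in>D. emeasure (K c) F \<partial>?L)" .
  qed
  define K' where "K' = cond_law M spins A spins B U C"
  have K': "is_cond_law M spins A spins B U C K'"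
    unfolding K'_def cond_law_def by (rule someI[of "is_cond_law M spins A spins B U C", OF K])
  have K'_borel: "K' \<in> U \<rightarrow>\<^sub>M prob_algebra (spins \<Otimes>\<^sub>M spins)"
    using K' by (simp add: is_cond_law_def)
  have sets_K': "sets (K' c) = sets (spins \<Otimes>\<^sub>M spins)" if "c \<in> space U" for c
    using measurable_space[OF K'_borel that] by (simp add: space_prob_algebra)
  \<comment> \<open>Both sides have the same integral over every measurable \<open>D\<close>, namely
    the probability of a joint event. With only four atoms, the exceptional null sets can be
    united.\<close>
  have "AE c in ?L. emeasure (K' c) {z} = k c z" if z: "z \<in> spin_pairs" for z
  proof (rule L.density_unique_finite_measure)
    have "K' \<in> U \<rightarrow>\<^sub>M subprob_algebra (spins \<Otimes>\<^sub>M spins)"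
      by (rule measurable_prob_algebraD[OF K'_borel])
    then show "(\<lambda>c. emeasure (K' c) {z}) \<in> borel_measurable ?L"
      using z by (simp add: measurable_emeasure_kernel sets_spins_pair)
    show "(\<integral>\<^sup>+c\<in>D. emeasure (K' c) {z} \<partial>?L) = (\<integral>\<^sup>+c\<in>D. k c z \<partial>?L)" if "D \<in> sets ?L" for D
    proof -
      have "{z} \<in> sets (spins \<Otimes>\<^sub>M spins)" "D \<in> sets U" using z that unfolding sets_spins_pair by auto
      note is_cond_lawD[OF K' this(2,1)] is_cond_lawD[OF K this(2,1)]
      then have "(\<integral>\<^sup>+c\<in>D. emeasure (K' c) {z} \<partial>?L) = (\<integral>\<^sup>+c\<in>D. emeasure (K c) {z} \<partial>?L)"
        by (rule trans[OF sym])
      then show ?thesis using z by (simp add: K_eq)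
    qed
  qed (auto simp: k_borel)
  then have "AE c in ?L. \<forall>z\<in>spin_pairs. emeasure (K' c) {z} = k c z"
    by (intro AE_finite_allI) auto
  then have "AE c in ?L. chi2_info spins spins (K' c) = ennreal ((m c)\<^sup>2)"
  proof (rule AE_mp[OF _ AE_I2], intro impI)
    fix c assume "c \<in> space ?L" and k: "\<forall>z\<in>spin_pairs. emeasure (K' c) {z} = k c z"
    then show "chi2_info spins spins (K' c) = ennreal ((m c)\<^sup>2)"
      by (intro chi2_info_spins sets_K' m_le) (auto simp: k_def)
  qed
  then show ?thesis
    unfolding cond_chi2_info_def K'_def[symmetric] by (rule nn_integral_cong_AE)
qed

text \<open>Both outputs are absolutely continuous with respect to their average, and their
  densities \<open>f\<close> and \<open>g\<close> add up to 2 almost everywhere. Hence they have the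
  form \<open>1 + \<theta>\<close> and \<open>1 - \<theta>\<close>, for any channel
  whatsoever.\<close>

lemma channel_decomposition:
  assumes "Q \<in> spins \<rightarrow>\<^sub>M prob_algebra N"
  shows "\<exists>\<mu> \<theta>. prob_space \<mu> \<and> sets \<mu> = sets N \<and> \<theta> \<in> borel_measurable \<mu> \<and> (\<forall>y. \<bar>\<theta> y\<bar> \<le> (1::real)) \<and>
    (\<integral>y. \<theta> y \<partial>\<mu>) = 0 \<and> (\<forall>s\<in>{-1, 1}. Q s = density \<mu> (\<lambda>y. ennreal (1 + of_int s * \<theta> y)))"
proof -
  have two_half: "(2::ennreal) * (a * ennreal (1/2)) = a" for a
  proof -
    have "(2::ennreal) * ennreal (1/2) = ennreal (2 * (1/2))" by (subst ennreal_mult) auto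
    then show ?thesis by (simp add: mult.left_commute)
  qed
  let ?B = "uniform_count_measure {-1, 1 :: int}"
  have Q: "prob_space (Q s)" "sets (Q s) = sets N" if "s \<in> {-1, 1}" for s
    using measurable_space[OF assms, of s] that by (auto simp: space_prob_algebra)
  have Q_kernel: "Q \<in> ?B \<rightarrow>\<^sub>M subprob_algebra N"
    using measurable_prob_algebraD[OF assms]
    by (subst measurable_cong_sets[OF _ refl, of _ spins]) (auto simp: sets_uniform_count_measure)
  \<comment> \<open>The average of the two outputs, realised as the output law for a uniform input
    spin.\<close>
  define \<mu> where "\<mu> = ?B \<bind> Q"
  have sets_\<mu>: "sets \<mu> = sets N"
    unfolding \<mu>_def by (rule sets_bind[OF sets_kernel[OF Q_kernel]]) (auto simp: space_uniform_count_measure)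
  have \<mu>: "emeasure \<mu> D = (emeasure (Q (-1)) D + emeasure (Q 1) D) * ennreal (1/2)" if "D \<in> sets N" for D
  proof -
    have "emeasure \<mu> D = (\<integral>\<^sup>+s. emeasure (Q s) D \<partial>?B)"
      unfolding \<mu>_def by (rule emeasure_bind[OF _ Q_kernel that]) (simp add: space_uniform_count_measure)
    also have "\<dots> = (\<Sum>s\<in>{-1, 1}. ennreal (1/2) * emeasure (Q s) D)"
      unfolding uniform_count_measure_def
      by (subst nn_integral_point_measure_finite) (auto simp: mult.commute numeral_2_eq_2)
    finally show ?thesis by (simp add: distrib_left mult.commute)
  qed
  interpret Qm: prob_space "Q (-1)" by (rule Q) simp
  interpret Qp: prob_space "Q 1" by (rule Q) simp
  have "space (Q 1) = space \<mu>" "space (Q (-1)) = space \<mu>"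
    by (auto intro!: sets_eq_imp_space_eq simp: sets_\<mu> Q)
  then have "emeasure \<mu> (space \<mu>) = 1"
    using Qm.emeasure_space_1 Qp.emeasure_space_1 \<mu>[of "space \<mu>"] sets.top[of \<mu>] sets_\<mu> two_half[of 1]
    by simp
  then interpret P: prob_space \<mu> by (rule prob_spaceI)
  have ac: "absolutely_continuous \<mu> (Q s)" if "s \<in> {-1, 1}" for s
    unfolding absolutely_continuous_def
  proof
    fix D assume "D \<in> null_sets \<mu>"
    then have "D \<in> sets N" "emeasure \<mu> D = 0" by (auto simp: sets_\<mu>)
    then show "D \<in> null_sets (Q s)" using that \<mu>[of D] Q(2)[of s] by (auto simp: null_sets_def)
  qed
  define f where "f = RN_deriv \<mu> (Q 1)"
  define g where "g = RN_deriv \<mu> (Q (-1))"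
  have [measurable]: "f \<in> borel_measurable \<mu>" "g \<in> borel_measurable \<mu>" by (auto simp: f_def g_def)
  have fd: "density \<mu> f = Q 1" and gd: "density \<mu> g = Q (-1)"
    unfolding f_def g_def by (auto intro!: P.density_RN_deriv ac simp: Q sets_\<mu>)
  have "density \<mu> (\<lambda>y. f y + g y) = density \<mu> (\<lambda>_. 2)"
  proof (rule measure_eqI)
    fix D assume "D \<in> sets (density \<mu> (\<lambda>y. f y + g y))"
    then have D [measurable]: "D \<in> sets \<mu>" by simp
    have "emeasure (density \<mu> (\<lambda>y. f y + g y)) D = emeasure (density \<mu> f) D + emeasure (density \<mu> g) D"
      by (simp add: emeasure_density distrib_right nn_integral_add)
    also have "\<dots> = 2 * emeasure \<mu> D"
    proof -
      show ?thesis using D two_half[of "emeasure (Q 1) D + emeasure (Q (-1)) D"]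
        by (simp add: fd gd \<mu> sets_\<mu> add.commute mult.commute)
    qed
    finally show "emeasure (density \<mu> (\<lambda>y. f y + g y)) D = emeasure (density \<mu> (\<lambda>_. 2)) D"
      by (simp add: emeasure_density nn_integral_cmult_indicator)
  qed simp
  then have fg: "AE y in \<mu>. f y + g y = 2"
    by (subst (asm) P.density_unique_iff) auto
  \<comment> \<open>The function is \<open>f - 1\<close>, clipped so that the bound holds at every
    point and not just almost everywhere. Since \<open>f \<le> 2\<close> almost everywhere, clipping
    changes it only on a null set.\<close>
  define \<theta> where "\<theta> y = max (-1) (min 1 (enn2real (f y) - 1))" for y
  have [measurable]: "\<theta> \<in> borel_measurable \<mu>" unfolding \<theta>_def by measurable
  have \<theta>_le: "\<bar>\<theta> y\<bar> \<le> 1" for y using enn2real_nonneg[of "f y"] unfolding \<theta>_def by linarith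
  have \<theta>_fg: "AE y in \<mu>. f y = ennreal (1 + \<theta> y) \<and> g y = ennreal (1 - \<theta> y)"
    using fg
  proof eventually_elim
    case (elim y)
    then have "f y \<le> 2" "f y < \<top>" "g y < \<top>"
      by (metis le_iff_add, metis ennreal_add_less_top ennreal_numeral_less_top, metis ennreal_add_less_top ennreal_numeral_less_top)
    then obtain a b where ab: "f y = ennreal a" "g y = ennreal b" "0 \<le> a" "0 \<le> b"
      by (metis enn2real_nonneg ennreal_enn2real)
    have "ennreal (a + b) = ennreal 2" using elim ab by simp
    then have "a + b = 2" using ab by (subst (asm) ennreal_inj) auto
    then show ?case using ab by (auto simp: \<theta>_def)
  qed
  have Qs: "Q s = density \<mu> (\<lambda>y. ennreal (1 + of_int s * \<theta> y))" if "s \<in> {-1, 1}" for s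
  proof -
    have "density \<mu> f = density \<mu> (\<lambda>y. ennreal (1 + \<theta> y))" "density \<mu> g = density \<mu> (\<lambda>y. ennreal (1 - \<theta> y))"
      using \<theta>_fg by (auto intro!: density_cong elim!: eventually_mono)
    then show ?thesis using that fd gd by auto
  qed
  have nonneg: "0 \<le> 1 + \<theta> y" for y using \<theta>_le[of y] by linarith
  have int: "integrable \<mu> \<theta>" by (rule P.integrable_const_bound[where B = 1]) (auto simp: \<theta>_le)
  have "(\<integral>\<^sup>+y. ennreal (1 + \<theta> y) \<partial>\<mu>) = emeasure (Q 1) (space \<mu>)"
    by (simp add: Qs emeasure_density cong: nn_integral_cong)
  also have "\<dots> = 1" using Qp.emeasure_space_1 \<open>space (Q 1) = space \<mu>\<close> by simp
  finally have "ennreal (\<integral>y. 1 + \<theta> y \<partial>\<mu>) = 1"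
    using int nonneg by (subst nn_integral_eq_integral[symmetric]) auto
  then have "(\<integral>y. \<theta> y \<partial>\<mu>) = 0" using int by (simp add: P.prob_space)
  then show ?thesis
    using P.prob_space_axioms sets_\<mu> \<theta>_le Qs by (intro exI[of _ \<mu>] exI[of _ \<theta>]) auto
qed


section \<open>The law of the observations\<close>

context edge_likelihoods
begin

lemma one_plus_spin_\<theta>_nonneg: "s \<in> {-1, 1} \<Longrightarrow> 0 \<le> 1 + of_int s * \<theta> e y"
  using \<theta>_le_1[of e y] by auto

definition channel :: "'e \<Rightarrow> int \<Rightarrow> 'y measure" where
  "channel e s = density (\<mu> e) (\<lambda>y. ennreal (1 + of_int s * \<theta> e y))"

lemma sets_channel [simp, measurable_cong]: "sets (channel e s) = sets (\<mu> e)"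
  by (simp add: channel_def)

lemma prob_space_channel:
  assumes "s \<in> {-1, 1}" shows "prob_space (channel e s)"
proof (rule prob_spaceI)
  have i: "integrable (\<mu> e) (\<theta> e)"
    by (rule M.integrable_const_bound[where B = 1]) (auto simp: \<theta>_le_1)
  have "emeasure (channel e s) (space (channel e s)) = (\<integral>\<^sup>+y. ennreal (1 + of_int s * \<theta> e y) \<partial>\<mu> e)"
    by (simp add: channel_def emeasure_density cong: nn_integral_cong)
  also have "\<dots> = ennreal (\<integral>y. 1 + of_int s * \<theta> e y \<partial>\<mu> e)"
    using one_plus_spin_\<theta>_nonneg[OF assms] i by (intro nn_integral_eq_integral) auto
  also have "\<dots> = 1" using i by (simp add: integral_\<theta> M.prob_space)
  finally show "emeasure (channel e s) (space (channel e s)) = 1" .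
qed

text \<open>A product measure is determined by its values on rectangles, where the integral of the
  product density splits into one factor per edge.\<close>

lemma PiM_channel:
  assumes "finite S" and s: "\<And>e. s e \<in> {-1, 1}"
  shows "Pi\<^sub>M S (\<lambda>e. channel e (s e)) =
    density (Pi\<^sub>M S \<mu>) (\<lambda>y. ennreal (\<Prod>e\<in>S. 1 + of_int (s e) * \<theta> e (y e)))"
proof (rule sym, rule product_sigma_finite.PiM_eqI)
  show "product_sigma_finite (\<lambda>e. channel e (s e))"
    unfolding product_sigma_finite_def
    using prob_space_channel[OF s] by (auto intro: prob_space_imp_sigma_finite)
  show "finite S" by fact
  show "sets (density (Pi\<^sub>M S \<mu>) (\<lambda>y. ennreal (\<Prod>e\<in>S. 1 + of_int (s e) * \<theta> e (y e))))
      = sets (Pi\<^sub>M S (\<lambda>e. channel e (s e)))"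
    by (simp cong: sets_PiM_cong)
  fix A assume A: "\<And>e. e \<in> S \<Longrightarrow> A e \<in> sets (channel e (s e))"
  have "emeasure (density (Pi\<^sub>M S \<mu>) (\<lambda>y. ennreal (\<Prod>e\<in>S. 1 + of_int (s e) * \<theta> e (y e)))) (Pi\<^sub>E S A)
      = (\<integral>\<^sup>+y. ennreal (\<Prod>e\<in>S. 1 + of_int (s e) * \<theta> e (y e)) * indicator (Pi\<^sub>E S A) y \<partial>Pi\<^sub>M S \<mu>)"
    using A \<open>finite S\<close> by (intro emeasure_density sets_PiM_I_finite) auto
  also have "\<dots> = (\<integral>\<^sup>+y. (\<Prod>e\<in>S. ennreal (1 + of_int (s e) * \<theta> e (y e)) * indicator (A e) (y e)) \<partial>Pi\<^sub>M S \<mu>)"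
  proof (rule nn_integral_cong)
    fix y assume "y \<in> space (Pi\<^sub>M S \<mu>)"
    then have "y \<in> extensional S" by (simp add: space_PiM PiE_iff)
    then have "indicator (Pi\<^sub>E S A) y = (\<Prod>e\<in>S. indicator (A e) (y e) :: ennreal)"
      using \<open>finite S\<close> by (auto simp: indicator_def PiE_iff)
    then show "ennreal (\<Prod>e\<in>S. 1 + of_int (s e) * \<theta> e (y e)) * indicator (Pi\<^sub>E S A) y
        = (\<Prod>e\<in>S. ennreal (1 + of_int (s e) * \<theta> e (y e)) * indicator (A e) (y e))"
      using one_plus_spin_\<theta>_nonneg[OF s] by (simp add: prod.distrib prod_ennreal)
  qed
  also have "\<dots> = (\<Prod>e\<in>S. \<integral>\<^sup>+y. ennreal (1 + of_int (s e) * \<theta> e y) * indicator (A e) y \<partial>\<mu> e)"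
    using A \<open>finite S\<close> by (intro product_nn_integral_prod) auto
  also have "\<dots> = (\<Prod>e\<in>S. emeasure (channel e (s e)) (A e))"
    using A by (intro prod.cong refl) (simp add: channel_def emeasure_density)
  finally show "emeasure (density (Pi\<^sub>M S \<mu>) (\<lambda>y. ennreal (\<Prod>e\<in>S. 1 + of_int (s e) * \<theta> e (y e)))) (Pi\<^sub>E S A)
      = (\<Prod>e\<in>S. emeasure (channel e (s e)) (A e))" .
qed

end

section \<open>Joint law of spins and observations in a spin synchronization model\<close>

locale spin_model = edge_likelihoods ends \<mu> \<theta>
  for ends :: "'e \<Rightarrow> 'v \<times> 'v" and \<mu> :: "'e \<Rightarrow> 'y measure" and \<theta> :: "'e \<Rightarrow> 'y \<Rightarrow> real" +
  fixes V :: "'v set" and E :: "'e set" and N :: "'e \<Rightarrow> 'y measure" and Q :: "'e \<Rightarrow> int \<Rightarrow> 'y measure"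
    and M :: "'a measure" and X :: "'v \<Rightarrow> 'a \<Rightarrow> int" and Y :: "'e \<Rightarrow> 'a \<Rightarrow> 'y"
  assumes sync: "spin_synchronization ends V E N Q M X Y"
    and sets_\<mu>: "\<And>e. e \<in> E \<Longrightarrow> sets (\<mu> e) = sets (N e)"
    and Q_eq_channel: "\<And>e s. e \<in> E \<Longrightarrow> s \<in> {-1, 1} \<Longrightarrow> Q e s = channel e s"
begin

sublocale Model: prob_space M
  using sync by (simp add: spin_synchronization_def)

lemma fin: "finite V" "finite E" and ends_E: "ends ` E \<subseteq> V \<times> V"
  using sync by (auto simp: spin_synchronization_def finite_multigraph_def)

lemma measurable_X: "w \<in> V \<Longrightarrow> X w \<in> M \<rightarrow>\<^sub>M spins"
  using sync by (auto simp: spin_synchronization_def Model.indep_vars_def)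

lemma X_cases: "w \<in> V \<Longrightarrow> \<omega> \<in> space M \<Longrightarrow> X w \<omega> \<in> {-1, 1}"
  using measurable_space[OF measurable_X] by simp

lemma measurable_observations: "S \<subseteq> E \<Longrightarrow> observations Y S \<in> M \<rightarrow>\<^sub>M Pi\<^sub>M S N"
  using sync unfolding observations_def spin_synchronization_def
  by (intro measurable_restrict) auto

lemma sets_PiM_\<mu>: "S \<subseteq> E \<Longrightarrow> sets (Pi\<^sub>M S \<mu>) = sets (Pi\<^sub>M S N)"
  by (intro sets_PiM_cong sets_\<mu>) auto

lemma sets_spin_event: "{\<omega> \<in> space M. \<forall>w\<in>V. X w \<omega> = x w} \<in> sets M" if "x \<in> spin_configs V"
proof -
  have "{\<omega> \<in> space M. X w \<omega> = x w} \<in> sets M" if "w \<in> V" for w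
  proof -
    have "X w -` {x w} \<inter> space M \<in> sets M"
      using \<open>x \<in> spin_configs V\<close> that by (intro measurable_sets[OF measurable_X]) (auto simp: spin_configs_def)
    also have "X w -` {x w} \<inter> space M = {\<omega> \<in> space M. X w \<omega> = x w}" by auto
    finally show ?thesis .
  qed
  then show ?thesis using fin by (intro sets.sets_Collect_finite_All) auto
qed

lemma emeasure_spin_event:
  assumes "x \<in> spin_configs V" "V \<noteq> {}"
  shows "emeasure M {\<omega> \<in> space M. \<forall>w\<in>V. X w \<omega> = x w} = ennreal (1 / 2 ^ card V)"
proof -
  have x: "{x w} \<in> sets spins" if "w \<in> V" for w using assms(1) that by (auto simp: spin_configs_def)
  have half: "measure M (X w -` {x w} \<inter> space M) = 1/2" if "w \<in> V" for w
  proof -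
    have "measure M (X w -` {x w} \<inter> space M) = measure (distr M spins (X w)) {x w}"
      by (rule measure_distr[symmetric, OF measurable_X[OF that] x[OF that]])
    also have "\<dots> = measure (uniform_count_measure {-1, 1}) {x w}"
      using sync that by (simp add: spin_synchronization_def)
    also have "\<dots> = 1/2" using x[OF that] by (subst measure_uniform_count_measure) auto
    finally show ?thesis .
  qed
  have "{\<omega> \<in> space M. \<forall>w\<in>V. X w \<omega> = x w} = (\<Inter>w\<in>V. X w -` {x w} \<inter> space M)"
    using assms(2) by auto
  also have "Model.prob \<dots> = (\<Prod>w\<in>V. Model.prob (X w -` {x w} \<inter> space M))"
    using sync assms(2) fin x by (intro Model.indep_varsD[of "\<lambda>_. spins" X V]) (auto simp: spin_synchronization_def)
  also have "\<dots> = 1 / 2 ^ card V" by (simp add: half power_one_over)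
  finally show ?thesis by (simp add: Model.emeasure_eq_measure)
qed

text \<open>The model prescribes the law of all observations given the spins. An event about the
  edges in \<open>S\<close> is a cylinder for that law, the marginal of a product measure is the
  product over \<open>S\<close>, and \<open>PiM_channel\<close> gives its density. The factor
  \<open>1 / 2 ^ card V\<close> is the prior probability of \<open>x\<close>.\<close>

lemma emeasure_spins_observations:
  assumes x: "x \<in> spin_configs V" and "V \<noteq> {}" and S: "S \<subseteq> E" and D: "D \<in> sets (Pi\<^sub>M S N)"
  shows "emeasure M {\<omega> \<in> space M. (\<forall>w\<in>V. X w \<omega> = x w) \<and> observations Y S \<omega> \<in> D} =
    (\<integral>\<^sup>+y\<in>D. ennreal (likelihood S y x / 2 ^ card V) \<partial>Pi\<^sub>M S \<mu>)"
proof -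
  let ?X = "{\<omega> \<in> space M. \<forall>w\<in>V. X w \<omega> = x w}"
  let ?D = "(\<lambda>y. restrict y S) -` D \<inter> space (Pi\<^sub>M E N)"
  let ?O = "observations Y E -` ?D \<inter> space M"
  \<comment> \<open>The value 1 off \<open>E\<close> is a default: every index must carry a genuine
    channel output for the product space to be interpreted.\<close>
  define s where "s e = (if e \<in> E then edge_spin ends x e else 1)" for e
  have s: "s e \<in> {-1, 1}" for e using edge_spin_cases[of e V x] ends_E x by (auto simp: s_def)
  have D' [measurable]: "?D \<in> sets (Pi\<^sub>M E N)"
    by (rule measurable_sets[OF measurable_restrict_subset[OF S] D])
  have sets_channels: "sets (Pi\<^sub>M T (\<lambda>e. channel e (s e))) = sets (Pi\<^sub>M T N)" if "T \<subseteq> E" for T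
    using that sets_\<mu> by (intro sets_PiM_cong) auto
  interpret T: product_prob_space "\<lambda>e. channel e (s e)" UNIV
    unfolding product_prob_space_def product_prob_space_axioms_def product_sigma_finite_def
    using prob_space_channel[OF s] by (auto intro: prob_space_imp_sigma_finite)
  have obs_restrict: "restrict (observations Y E \<omega>) S = observations Y S \<omega>" for \<omega>
    using S by (auto simp: observations_def fun_eq_iff)
  have "distr (uniform_measure M ?X) (Pi\<^sub>M E N) (observations Y E) = Pi\<^sub>M E (\<lambda>e. Q e (edge_spin ends x e))"
    using sync x by (auto simp: spin_synchronization_def spin_configs_def)
  also have "\<dots> = Pi\<^sub>M E (\<lambda>e. channel e (s e))"
    by (intro PiM_cong refl) (use s in \<open>metis Q_eq_channel s_def\<close>)
  finally have "emeasure (Pi\<^sub>M E (\<lambda>e. channel e (s e))) ?D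
      = emeasure (distr (uniform_measure M ?X) (Pi\<^sub>M E N) (observations Y E)) ?D" by simp
  also have "\<dots> = emeasure (uniform_measure M ?X) ?O"
    using measurable_observations[of E] D' by (subst emeasure_distr) auto
  also have "\<dots> = emeasure M (?X \<inter> ?O) / emeasure M ?X"
    using measurable_observations[of E] D' sets_spin_event[OF x]
    by (intro emeasure_uniform_measure measurable_sets) auto
  also have "?X \<inter> ?O = {\<omega> \<in> space M. (\<forall>w\<in>V. X w \<omega> = x w) \<and> observations Y S \<omega> \<in> D}"
    using measurable_space[OF measurable_observations[of E]] by (auto simp: obs_restrict)
  finally have 1: "emeasure M {\<omega> \<in> space M. (\<forall>w\<in>V. X w \<omega> = x w) \<and> observations Y S \<omega> \<in> D} / ennreal (1 / 2 ^ card V)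
      = emeasure (Pi\<^sub>M E (\<lambda>e. channel e (s e))) ?D"
    by (simp only: emeasure_spin_event[OF x \<open>V \<noteq> {}\<close>])
  have "emeasure (Pi\<^sub>M E (\<lambda>e. channel e (s e))) ?D
      = emeasure (distr (Pi\<^sub>M E (\<lambda>e. channel e (s e))) (Pi\<^sub>M S (\<lambda>e. channel e (s e))) (\<lambda>y. restrict y S)) D"
    using D S sets_channels[OF S] sets_channels[OF subset_refl]
    by (subst emeasure_distr) (auto intro!: measurable_restrict_subset arg_cong[where f = "emeasure _"] dest: sets_eq_imp_space_eq)
  also have "\<dots> = emeasure (Pi\<^sub>M S (\<lambda>e. channel e (s e))) D"
    by (subst T.distr_restrict[OF S fin(2), symmetric]) simp
  also have "\<dots> = (\<integral>\<^sup>+y\<in>D. ennreal (\<Prod>e\<in>S. 1 + of_int (s e) * \<theta> e (y e)) \<partial>Pi\<^sub>M S \<mu>)"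
    using D finite_subset[OF S fin(2)] s
    by (subst PiM_channel) (auto simp: emeasure_density sets_PiM_\<mu>[OF S])
  also have "\<dots> = (\<integral>\<^sup>+y\<in>D. ennreal (likelihood S y x) \<partial>Pi\<^sub>M S \<mu>)"
  proof -
    have "(\<Prod>e\<in>S. 1 + of_int (s e) * \<theta> e (y e)) = likelihood S y x" for y
      unfolding likelihood_def using S by (intro prod.cong) (auto simp: s_def)
    then show ?thesis by simp
  qed
  finally have 2: "emeasure (Pi\<^sub>M E (\<lambda>e. channel e (s e))) ?D = (\<integral>\<^sup>+y\<in>D. ennreal (likelihood S y x) \<partial>Pi\<^sub>M S \<mu>)" .
  \<comment> \<open>Conditioning is undone by multiplying with the probability of the spin event,
    which is positive and finite.\<close>
  have "emeasure M {\<omega> \<in> space M. (\<forall>w\<in>V. X w \<omega> = x w) \<and> observations Y S \<omega> \<in> D}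
      = emeasure M {\<omega> \<in> space M. (\<forall>w\<in>V. X w \<omega> = x w) \<and> observations Y S \<omega> \<in> D}
        / ennreal (1 / 2 ^ card V) * ennreal (1 / 2 ^ card V)"
    unfolding ennreal_divide_times by (subst ennreal_divide_self) auto
  also have "\<dots> = (\<integral>\<^sup>+y\<in>D. ennreal (likelihood S y x) \<partial>Pi\<^sub>M S \<mu>) * ennreal (1 / 2 ^ card V)"
    by (simp only: 1 2)
  also have "\<dots> = (\<integral>\<^sup>+y. ennreal (likelihood S y x) * indicator D y * ennreal (1 / 2 ^ card V) \<partial>Pi\<^sub>M S \<mu>)"
  proof (rule nn_integral_multc[symmetric])
    note [measurable] = local_funD(2)[OF local_fun_likelihood, of S S x]
    have [measurable]: "D \<in> sets (Pi\<^sub>M S \<mu>)" using D by (simp add: sets_PiM_\<mu>[OF S])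
    show "(\<lambda>y. ennreal (likelihood S y x) * indicator D y) \<in> borel_measurable (Pi\<^sub>M S \<mu>)"
      by simp
  qed
  also have "\<dots> = (\<integral>\<^sup>+y\<in>D. ennreal (likelihood S y x / 2 ^ card V) \<partial>Pi\<^sub>M S \<mu>)"
  proof (rule nn_integral_cong)
    fix y
    have "0 \<le> likelihood S y x" using S ends_E x by (intro likelihood_nonneg[where V = V]) auto
    then have "ennreal (likelihood S y x) * ennreal (1 / 2 ^ card V) = ennreal (likelihood S y x / 2 ^ card V)"
      by (subst ennreal_mult[symmetric]) auto
    then show "ennreal (likelihood S y x) * indicator D y * ennreal (1 / 2 ^ card V)
        = ennreal (likelihood S y x / 2 ^ card V) * indicator D y"
      by (metis mult.commute mult.left_commute)
  qed
  finally show ?thesis .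
qed

text \<open>The events for single configurations are disjoint, so their measures add. All
  configurations together give the law of the observations; those with two prescribed spins give the
  joint law needed for the information.\<close>

lemma emeasure_configs_observations:
  assumes A: "A \<subseteq> spin_configs V" and "V \<noteq> {}" and S: "S \<subseteq> E" and D: "D \<in> sets (Pi\<^sub>M S N)"
  shows "emeasure M {\<omega> \<in> space M. (\<lambda>w\<in>V. X w \<omega>) \<in> A \<and> observations Y S \<omega> \<in> D} =
    (\<integral>\<^sup>+y\<in>D. ennreal ((\<Sum>x\<in>A. likelihood S y x) / 2 ^ card V) \<partial>Pi\<^sub>M S \<mu>)"
proof -
  let ?G = "\<lambda>x. {\<omega> \<in> space M. (\<forall>w\<in>V. X w \<omega> = x w) \<and> observations Y S \<omega> \<in> D}"
  have eq: "(\<lambda>w\<in>V. X w \<omega>) = x \<longleftrightarrow> (\<forall>w\<in>V. X w \<omega> = x w)" if "x \<in> A" for x \<omega>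
    using A that by (auto simp: spin_configs_def fun_eq_iff PiE_iff extensional_def)
  have fin_A: "finite A" using finite_subset[OF A] fin by simp
  have meas: "?G x \<in> sets M" if "x \<in> A" for x
  proof -
    have "?G x = {\<omega> \<in> space M. \<forall>w\<in>V. X w \<omega> = x w} \<inter> (observations Y S -` D \<inter> space M)" by auto
    then show ?thesis
      using sets_spin_event[of x] that A measurable_sets[OF measurable_observations[OF S] D] by auto
  qed
  have "{\<omega> \<in> space M. (\<lambda>w\<in>V. X w \<omega>) \<in> A \<and> observations Y S \<omega> \<in> D} = (\<Union>x\<in>A. ?G x)"
  proof -
    have "(\<lambda>w\<in>V. X w \<omega>) \<in> A \<longleftrightarrow> (\<exists>x\<in>A. (\<lambda>w\<in>V. X w \<omega>) = x)" for \<omega> by simp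
    then have "(\<lambda>w\<in>V. X w \<omega>) \<in> A \<longleftrightarrow> (\<exists>x\<in>A. \<forall>w\<in>V. X w \<omega> = x w)" for \<omega>
      by (simp only: eq cong: bex_cong)
    then show ?thesis by auto
  qed
  also have "emeasure M \<dots> = (\<Sum>x\<in>A. emeasure M (?G x))"
  proof (rule sum_emeasure[symmetric])
    show "disjoint_family_on ?G A"
      unfolding disjoint_family_on_def
    proof (intro ballI impI equals0I)
      fix x y \<omega> assume "x \<in> A" "y \<in> A" "x \<noteq> y" "\<omega> \<in> ?G x \<inter> ?G y"
      then have "(\<lambda>w\<in>V. X w \<omega>) = x" "(\<lambda>w\<in>V. X w \<omega>) = y"
        using eq[of x \<omega>] eq[of y \<omega>] by blast+
      then show False using \<open>x \<noteq> y\<close> by simp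
    qed
  qed (use meas fin_A in auto)
  also have "\<dots> = (\<Sum>x\<in>A. \<integral>\<^sup>+y\<in>D. ennreal (likelihood S y x / 2 ^ card V) \<partial>Pi\<^sub>M S \<mu>)"
    using A assms(2) S D by (intro sum.cong refl emeasure_spins_observations) auto
  also have "\<dots> = (\<integral>\<^sup>+y. (\<Sum>x\<in>A. ennreal (likelihood S y x / 2 ^ card V) * indicator D y) \<partial>Pi\<^sub>M S \<mu>)"
  proof (rule nn_integral_sum[symmetric])
    fix x
    note [measurable] = local_funD(2)[OF local_fun_likelihood, of S S x]
    have [measurable]: "D \<in> sets (Pi\<^sub>M S \<mu>)" using D by (simp add: sets_PiM_\<mu>[OF S])
    show "(\<lambda>y. ennreal (likelihood S y x / 2 ^ card V) * indicator D y) \<in> borel_measurable (Pi\<^sub>M S \<mu>)"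
      by simp
  qed
  also have "\<dots> = (\<integral>\<^sup>+y\<in>D. ennreal ((\<Sum>x\<in>A. likelihood S y x) / 2 ^ card V) \<partial>Pi\<^sub>M S \<mu>)"
  proof (rule nn_integral_cong)
    fix y
    have "0 \<le> likelihood S y x" if "x \<in> A" for x
      using S ends_E A that by (intro likelihood_nonneg[where V = V]) auto
    then have "(\<Sum>x\<in>A. ennreal (likelihood S y x / 2 ^ card V)) = ennreal ((\<Sum>x\<in>A. likelihood S y x) / 2 ^ card V)"
      by (subst sum_ennreal) (auto simp: sum_divide_distrib)
    then show "(\<Sum>x\<in>A. ennreal (likelihood S y x / 2 ^ card V) * indicator D y)
        = ennreal ((\<Sum>x\<in>A. likelihood S y x) / 2 ^ card V) * indicator D y"
      by (simp flip: sum_distrib_right)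
  qed
  finally show ?thesis .
qed

lemma distr_observations:
  assumes "V \<noteq> {}" and S: "S \<subseteq> E"
  shows "distr M (Pi\<^sub>M S N) (observations Y S) = density (Pi\<^sub>M S \<mu>) (\<lambda>y. ennreal (evidence V S y))"
proof (rule measure_eqI)
  show "sets (distr M (Pi\<^sub>M S N) (observations Y S)) = sets (density (Pi\<^sub>M S \<mu>) (\<lambda>y. ennreal (evidence V S y)))"
    by (simp add: sets_PiM_\<mu>[OF S])
  fix D assume "D \<in> sets (distr M (Pi\<^sub>M S N) (observations Y S))"
  then have D: "D \<in> sets (Pi\<^sub>M S N)" by simp
  have "emeasure (distr M (Pi\<^sub>M S N) (observations Y S)) D = emeasure M (observations Y S -` D \<inter> space M)"
    by (rule emeasure_distr[OF measurable_observations[OF S] D])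
  also have "observations Y S -` D \<inter> space M
      = {\<omega> \<in> space M. (\<lambda>w\<in>V. X w \<omega>) \<in> spin_configs V \<and> observations Y S \<omega> \<in> D}"
    using X_cases by (auto simp: spin_configs_def PiE_iff)
  also have "emeasure M \<dots> = (\<integral>\<^sup>+y\<in>D. ennreal (evidence V S y) \<partial>Pi\<^sub>M S \<mu>)"
    by (simp add: emeasure_configs_observations[OF subset_refl assms D] evidence_def spin_average_def)
  also have "\<dots> = emeasure (density (Pi\<^sub>M S \<mu>) (\<lambda>y. ennreal (evidence V S y))) D"
    using D local_funD(2)[OF local_fun_evidence, of S S V]
    by (intro emeasure_density[symmetric]) (auto simp: sets_PiM_\<mu>[OF S])
  finally show "emeasure (distr M (Pi\<^sub>M S N) (observations Y S)) D
      = emeasure (density (Pi\<^sub>M S \<mu>) (\<lambda>y. ennreal (evidence V S y))) D" .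
qed

text \<open>Bayes' rule: the joint density of the two end spins and the observations is
  \<open>(p + s t q) / 4\<close>, which is \<open>p * (1 + s t m) / 4\<close> with \<open>m\<close>
  the posterior. The observations have density \<open>p\<close>, so
  \<open>cond_chi2_info_spins\<close> gives the integral of
  \<open>p * m\<^sup>2 = q * m\<close>.\<close>

lemma cond_chi2_info_eq_information:
  assumes u: "u \<in> V" and v: "v \<in> V" and S: "S \<subseteq> E"
  shows "cond_chi2_info M spins (X u) spins (X v) (Pi\<^sub>M S N) (observations Y S)
    = ennreal (information V S u v)"
proof -
  have V: "V \<noteq> {}" using u by auto
  have ends_S: "ends ` S \<subseteq> V \<times> V" using S ends_E by auto
  let ?L = "distr M (Pi\<^sub>M S N) (observations Y S)" and ?m = "posterior V S u v"
  note lf = local_funD(2)[OF local_fun_evidence[of S V] subset_refl]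
    local_funD(2)[OF local_fun_correlation[of S V u v] subset_refl]
    local_funD(2)[OF local_fun_posterior[OF ends_S u v] subset_refl]
  note [measurable] = lf
  have ev: "0 \<le> evidence V S y" for y by (rule evidence_nonneg[OF ends_S])
  have m_le: "\<bar>?m y\<bar> \<le> 1" for y by (rule abs_posterior_le_1[OF ends_S u v])
  have corr: "correlation V S u v y = evidence V S y * ?m y" for y
    by (rule correlation_eq_posterior[OF ends_S u v])
  have L: "?L = density (Pi\<^sub>M S \<mu>) (\<lambda>y. ennreal (evidence V S y))"
    by (rule distr_observations[OF V S])
  have "cond_chi2_info M spins (X u) spins (X v) (Pi\<^sub>M S N) (observations Y S) = (\<integral>\<^sup>+y. ennreal ((?m y)\<^sup>2) \<partial>?L)"
  proof (rule cond_chi2_info_spins)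
    show "?m \<in> borel_measurable (Pi\<^sub>M S N)"
      using lf(3) by (simp add: measurable_cong_sets[OF sets_PiM_\<mu>[OF S] refl])
    fix s t :: int and D assume st: "s \<in> {-1, 1}" "t \<in> {-1, 1 :: int}" and D: "D \<in> sets (Pi\<^sub>M S N)"
    have [measurable]: "D \<in> sets (Pi\<^sub>M S \<mu>)" using D by (simp add: sets_PiM_\<mu>[OF S])
    let ?A = "{x \<in> spin_configs V. x u = s \<and> x v = t}"
    have "{\<omega> \<in> space M. observations Y S \<omega> \<in> D \<and> X u \<omega> = s \<and> X v \<omega> = t}
        = {\<omega> \<in> space M. (\<lambda>w\<in>V. X w \<omega>) \<in> ?A \<and> observations Y S \<omega> \<in> D}"
      using X_cases u v by (auto simp: spin_configs_def PiE_iff)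
    also have "emeasure M \<dots> = (\<integral>\<^sup>+y\<in>D. ennreal ((\<Sum>x\<in>?A. likelihood S y x) / 2 ^ card V) \<partial>Pi\<^sub>M S \<mu>)"
      by (rule emeasure_configs_observations[OF _ V S D]) auto
    also have "\<dots> = (\<integral>\<^sup>+y\<in>D. ennreal (evidence V S y * ((1 + of_int (s * t) * ?m y) / 4)) \<partial>Pi\<^sub>M S \<mu>)"
    proof -
      have "(\<Sum>x\<in>?A. likelihood S y x) / 2 ^ card V = evidence V S y * ((1 + of_int (s * t) * ?m y) / 4)" for y
      proof -
        have "(\<Sum>x\<in>?A. likelihood S y x) / 2 ^ card V
            = (evidence V S y + of_int (s * t) * correlation V S u v y) / 4"
          unfolding evidence_def correlation_def spin_average_def
          by (subst sum_fixed_two_spins[OF fin(1) u v st]) (auto simp: likelihood_flip[OF ends_S] field_simps)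
        then show ?thesis by (simp add: corr algebra_simps)
      qed
      then show ?thesis by (simp only:)
    qed
    also have "\<dots> = (\<integral>\<^sup>+y. ennreal (evidence V S y) * (ennreal ((1 + of_int (s * t) * ?m y) / 4) * indicator D y) \<partial>Pi\<^sub>M S \<mu>)"
      by (simp only: ennreal_mult'[OF ev] mult.assoc)
    also have "\<dots> = (\<integral>\<^sup>+y\<in>D. ennreal ((1 + of_int (s * t) * ?m y) / 4) \<partial>?L)"
      unfolding L by (rule nn_integral_density[symmetric]) measurable
    finally show "emeasure M {\<omega> \<in> space M. observations Y S \<omega> \<in> D \<and> X u \<omega> = s \<and> X v \<omega> = t}
        = (\<integral>\<^sup>+y\<in>D. ennreal ((1 + of_int (s * t) * ?m y) / 4) \<partial>?L)" .
  qed (use measurable_X u v measurable_observations[OF S] m_le Model.prob_space_axioms in auto)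
  also have "\<dots> = (\<integral>\<^sup>+y. ennreal (evidence V S y) * ennreal ((?m y)\<^sup>2) \<partial>Pi\<^sub>M S \<mu>)"
    unfolding L by (rule nn_integral_density) measurable
  also have "\<dots> = (\<integral>\<^sup>+y. ennreal (correlation V S u v y * ?m y) \<partial>Pi\<^sub>M S \<mu>)"
    by (simp add: corr ev power2_eq_square mult.assoc flip: ennreal_mult')
  also have "\<dots> = ennreal (information V S u v)"
    unfolding information_eq_posterior
  proof (rule nn_integral_eq_integral)
    show "integrable (Pi\<^sub>M S \<mu>) (\<lambda>y. correlation V S u v y * ?m y)"
      by (intro integrable_local_fun[OF _ subset_refl] local_fun_mult local_fun_correlation
          local_fun_posterior[OF ends_S u v])
    have "0 \<le> correlation V S u v y * ?m y" for y
      using mult_nonneg_nonneg[OF ev[of y], of "?m y * ?m y"] by (simp add: corr mult.assoc)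
    then show "AE y in Pi\<^sub>M S \<mu>. 0 \<le> correlation V S u v y * ?m y" by simp
  qed
  finally show ?thesis .
qed

end

theorem theorem1p2:
  fixes ends :: "'e \<Rightarrow> 'v \<times> 'v" and V :: "'v set" and E :: "'e set" and u v :: 'v
    and N :: "'e \<Rightarrow> 'y measure" and Q :: "'e \<Rightarrow> int \<Rightarrow> 'y measure"
    and M :: "'a measure" and X :: "'v \<Rightarrow> 'a \<Rightarrow> int" and Y :: "'e \<Rightarrow> 'a \<Rightarrow> 'y"
  assumes "series_parallel ends V E u v"
    and "spin_synchronization ends V E N Q M X Y"
  shows "cond_chi2_info M spins (X u) spins (X v) (Pi\<^sub>M E N) (observations Y E)
    \<le> (\<Sum>P\<in>paths ends V E u v.
        cond_chi2_info M spins (X u) spins (X v)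
          (Pi\<^sub>M (path_edges P) N) (observations Y (path_edges P)))"
proof -
  \<comment> \<open>edges outside \<open>E\<close> get a dummy measure, so that the product measure locale applies to all indices\<close>
  have "\<exists>\<mu> \<theta>. prob_space \<mu> \<and> \<theta> \<in> borel_measurable \<mu> \<and> (\<forall>y. \<bar>\<theta> y\<bar> \<le> (1::real)) \<and> (\<integral>y. \<theta> y \<partial>\<mu>) = 0 \<and>
    (e \<in> E \<longrightarrow> sets \<mu> = sets (N e) \<and> (\<forall>s\<in>{-1, 1}. Q e s = density \<mu> (\<lambda>y. ennreal (1 + of_int s * \<theta> y))))" for e
  proof (cases "e \<in> E")
    case True
    then have "Q e \<in> spins \<rightarrow>\<^sub>M prob_algebra (N e)"
      using assms(2) by (simp add: spin_synchronization_def)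
    from channel_decomposition[OF this] show ?thesis by blast
  next
    case False
    have "prob_space (return (count_space UNIV) (undefined :: 'y))" by (rule prob_space_return) simp
    then show ?thesis
      using False by (intro exI[of _ "return (count_space UNIV) (undefined :: 'y)"] exI[of _ "\<lambda>_. 0"]) simp
  qed
  then obtain \<mu> \<theta> where \<mu>\<theta>: "\<And>e. prob_space (\<mu> e)" "\<And>e. \<theta> e \<in> borel_measurable (\<mu> e)"
    "\<And>e y. \<bar>\<theta> e y\<bar> \<le> (1::real)" "\<And>e. (\<integral>y. \<theta> e y \<partial>\<mu> e) = 0"
    "\<And>e. e \<in> E \<Longrightarrow> sets (\<mu> e) = sets (N e)"
    "\<And>e s. e \<in> E \<Longrightarrow> s \<in> {-1, 1} \<Longrightarrow> Q e s = density (\<mu> e) (\<lambda>y. ennreal (1 + of_int s * \<theta> e y))"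
    by metis
  interpret edge_likelihoods ends \<mu> \<theta> by (rule edge_likelihoods.intro) (rule \<mu>\<theta>)+
  interpret spin_model ends \<mu> \<theta> V E N Q M X Y
    by unfold_locales (simp_all add: assms(2) \<mu>\<theta>(5,6) channel_def)
  have uv: "u \<in> V" "v \<in> V" using series_parallel_wf[OF assms(1)] by auto
  \<comment> \<open>The edge-weight product of each path is turned back into the information of that
    path, now taken inside the full vertex set \<open>V\<close> on which the model lives.\<close>
  have "information V E u v \<le> (\<Sum>P\<in>paths ends V E u v. information V (path_edges P) u v)"
    using information_le_sum_paths[OF assms(1)] by (simp add: information_path[OF fin(1)])
  then have "ennreal (information V E u v) \<le> ennreal (\<Sum>P\<in>paths ends V E u v. information V (path_edges P) u v)"
    by (rule ennreal_leI)
  also have "\<dots> = (\<Sum>P\<in>paths ends V E u v. ennreal (information V (path_edges P) u v))"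
    by (rule sum_ennreal[symmetric])
       (auto simp: information_path[OF fin(1)] intro!: prod_nonneg integral_nonneg_AE)
  finally show ?thesis
    by (simp add: cond_chi2_info_eq_information[OF uv] path_edges_subset)
qed

end
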